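(* Let $N\ge 1$ be an integer. Assume that the residue field $\tilde K$ of $K$ has characteristic zero. Let $a\in\mathbb{T}^N_K$, and for each integer $\ell\ge 1$ define $Z_\ell=\{a,a^2,\dots,a^\ell\}$, considered as a multiset in $\mathbb{T}^N_K\subset\mathbb{P}^N(K)\subset\mathbf{P}^N_K$ of cardinality $|Z_\ell|=\ell$. Then the sequence $\langle Z_\ell\rangle_{\ell=1}^{\infty}$ is $\delta_\gamma$-equidistributed in $\mathbf{P}^N_K$ if and only if the point $\tilde a$ is non-degenerate in $\mathbb{G}_m^N(\tilde K)$.
   Context: $K$ is a field complete with respect to a nontrivial non-archimedean absolute value $|\cdot|$, with valuation ring $K^\circ=\{a\in K: |a|\le 1\}$, maximal ideal $K^{\circ\circ}=\{a\in K:|a|<1\}$ and residue field $\tilde K=K^\circ/K^{\circ\circ}$; for $a\in K^\circ$, $\tilde a$ denotes its image in $\tilde K$. $\mathbb{K}$ denotes the completion of an algebraic closure of $K$ with respect to the unique extension of $|\cdot|$. $K[X]=K[X_0,\dots,X_N]$. Berkovich affine space: $\mathbf{A}^{N+1}_K$ is the set of multiplicative seminorms on $K[X]$ extending $|\cdot|$, i.e. functions $[\cdot]:K[X]\to[0,\infty)$ with $[a]=|a|$ for $a\in K$, $[f+g]\le\max\{[f],[g]\}$ and $[fg]=[f][g]$. The seminorm corresponding to a point $\zeta$ is written $[\cdot]_\zeta$. The topology is the weakest one making $\zeta\mapsto[f]_\zeta$ continuous for every $f\in K[X]$. A point $a\in K^{N+1}$ is identified with the seminorm $[f]_a=|f(a)|$;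 in particular $0$ denotes the point given by $f\mapsto|f(0)|$. Berkovich projective space: $\mathbf{P}^N_K$ is the quotient of $\mathbf{A}^{N+1}_K\setminus\{0\}$, with the quotient topology, by the equivalence relation: $\zeta\sim\xi$ iff there is a constant $\lambda>0$ with $[f]_\zeta=\lambda^{\deg f}[f]_\xi$ for all homogeneous $f\in K[X]$. Let $\pi$ be the quotient map. The inclusion $K^{N+1}\setminus\{0\}\subset\mathbf{A}^{N+1}_K\setminus\{0\}$ induces an inclusion $\mathbb{P}^N(K)\subset\mathbf{P}^N_K$. Gauss point: $\zeta_{0,1}\in\mathbf{A}^{N+1}_K$ is the point given by $[f]_{\zeta_{0,1}}=\sup\{|f(b)|: b\in\mathbb{K}^{N+1},\ |b_n|\le 1\text{ for all } 0\le n\le N\}$; the Gauss point of $\mathbf{P}^N_K$ is $\gamma=\pi(\zeta_{0,1})$, and $\delta_\gamma$ is the unit Dirac measure at $\gamma$. Equidistribution: for a unit Borel measure $\mu$ on $\mathbf{P}^N_K$, a sequence $\langle Z_\ell\rangle$ of nonempty finite multisets in $\mathbf{P}^N_K$ is $\mu$-equidistributed if $\frac{1}{|Z_\ell|}\sum_{z\in Z_\ell}\varphi(z)\to\int\varphi\,d\mu$ for every continuous $\varphi:\mathbf{P}^N_K\to\mathbb{R}$ (cardinalities and sums counted with multiplicity). Unit torus: $\mathbb{T}^N_K=\{(a_0:a_1:\dots:a_N)\in\mathbb{P}^N(K): |a_0|=|a_1|=\dots=|a_N|=1\}$ (representatives with this property exist), a group under coordinatewise multiplication; $a^j$ denotes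 the $j$-th power in this group. $\mathbb{G}_m^N$ is identified with the subvariety $x_0x_1\cdots x_N\ne 0$ of $\mathbb{P}^N$, with group law given by coordinatewise multiplication. For $a=(a_0:\dots:a_N)\in\mathbb{T}^N_K$ with all $|a_n|=1$, its reduction is $\tilde a=(\tilde a_0:\dots:\tilde a_N)\in\mathbb{G}_m^N(\tilde K)$. A point $b=(1:b_1:\dots:b_N)\in\mathbb{G}_m^N(k)$ over a field $k$ of characteristic zero is degenerate if $b_1,\dots,b_N$ are multiplicatively dependent in $k^\times$ (there is a nonzero $(\ell_1,\dots,\ell_N)\in\mathbb{Z}^N$ with $b_1^{\ell_1}\cdots b_N^{\ell_N}=1$); equivalently, $b$ lies in some proper algebraic subgroup of $\mathbb{G}_m^N$. Otherwise $b$ is non-degenerate. *)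

theory Defs
  imports
    "HOL-Algebra.Algebraic_Closure_Type"
    "HOL-Algebra.QuotRing"
    "HOL-Library.Poly_Mapping"
    "HOL-Library.Multiset"
    "HOL-Probability.Giry_Monad"
begin

section \<open>Valued fields\<close>

definition nonarch_abs :: "('k::field \<Rightarrow> real) \<Rightarrow> bool" where
  "nonarch_abs v \<longleftrightarrow>
     (\<forall>x. 0 \<le> v x) \<and> (\<forall>x. v x = 0 \<longleftrightarrow> x = 0) \<and>
     (\<forall>x y. v (x * y) = v x * v y) \<and> (\<forall>x y. v (x + y) \<le> max (v x) (v y))"

definition nontrivial_abs :: "('k::field \<Rightarrow> real) \<Rightarrow> bool" where
  "nontrivial_abs v \<longleftrightarrow> (\<exists>x. x \<noteq> 0 \<and> v x \<noteq> 1)"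

abbreviation abs_dist :: "('k::field \<Rightarrow> real) \<Rightarrow> 'k \<Rightarrow> 'k \<Rightarrow> real" where
  "abs_dist v \<equiv> (\<lambda>x y. v (x - y))"

definition complete_abs :: "('k::field \<Rightarrow> real) \<Rightarrow> bool" where
  "complete_abs v \<longleftrightarrow> Metric_space.mcomplete UNIV (abs_dist v)"

text \<open>
  The field \<open>'c\<close> with absolute value \<open>w\<close> is, through the embedding \<open>\<iota>\<close>, a completion of the
  algebraic closure of \<open>'k\<close> with respect to an extension of \<open>v\<close>: the function
  \<open>\<lambda>x. w (\<iota> x)\<close> is a non-archimedean absolute value on the algebraic closure extending \<open>v\<close>
  (for complete \<open>v\<close> the only one), and \<open>\<iota>\<close> has dense image in the complete field \<open>'c\<close>. This
  determines \<open>(w, \<iota>)\<close> up to isometric isomorphism.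
\<close>

definition completed_alg_closure ::
    "('k::field \<Rightarrow> real) \<Rightarrow> ('c::field \<Rightarrow> real) \<Rightarrow> ('k alg_closure \<Rightarrow> 'c) \<Rightarrow> bool" where
  "completed_alg_closure v w \<iota> \<longleftrightarrow>
     nonarch_abs w \<and> complete_abs w \<and>
     \<iota> \<in> ring_hom ring_of_type_algebra ring_of_type_algebra \<and>
     (\<forall>x. w (\<iota> (to_ac x)) = v x) \<and>
     Abstract_Topology.closure_of (Metric_space.mtopology UNIV (abs_dist w)) (\<iota> ` UNIV) = UNIV"

definition valuation_ring :: "('k::field \<Rightarrow> real) \<Rightarrow> 'k ring" where
  "valuation_ring v = ring_of_type_algebra \<lparr>carrier := {x. v x \<le> 1}\<rparr>"

definition valuation_ideal :: "('k::field \<Rightarrow> real) \<Rightarrow> 'k set" where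
  "valuation_ideal v = {x. v x < 1}"

definition residue_field :: "('k::field \<Rightarrow> real) \<Rightarrow> 'k set ring" where
  "residue_field v = valuation_ring v Quot valuation_ideal v"

definition residue :: "('k::field \<Rightarrow> real) \<Rightarrow> 'k \<Rightarrow> 'k set" where
  "residue v x = valuation_ideal v +>\<^bsub>valuation_ring v\<^esub> x"

definition char_zero :: "('a, 'b) ring_scheme \<Rightarrow> bool" where
  "char_zero F \<longleftrightarrow> (\<forall>n::nat. n > 0 \<longrightarrow> add_pow F n \<one>\<^bsub>F\<^esub> \<noteq> \<zero>\<^bsub>F\<^esub>)"


section \<open>Projective space over a field and its torus\<close>

text \<open>
  A rational point of projective space is the set of all its homogeneous coordinate vectors;
  \<open>proj_point F x\<close> is the point with homogeneous coordinates \<open>x\<close>. Operations on points are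
  given on representatives and extended to classes by a union over the representatives, as
  usual for quotients in HOL.
\<close>

definition proj_point :: "('a, 'b) ring_scheme \<Rightarrow> ('i \<Rightarrow> 'a) \<Rightarrow> ('i \<Rightarrow> 'a) set" where
  "proj_point F x = {\<lambda>i. c \<otimes>\<^bsub>F\<^esub> x i | c. c \<in> Units F}"

definition proj_space :: "('a, 'b) ring_scheme \<Rightarrow> ('i \<Rightarrow> 'a) set set" where
  "proj_space F = {proj_point F x | x. (\<forall>i. x i \<in> carrier F) \<and> (\<exists>i. x i \<noteq> \<zero>\<^bsub>F\<^esub>)}"

definition unit_torus :: "('k::field \<Rightarrow> real) \<Rightarrow> ('i \<Rightarrow> 'k) set monoid" where
  "unit_torus v =
     \<lparr>carrier = {P \<in> proj_space ring_of_type_algebra. \<exists>x\<in>P. \<forall>i. v (x i) = 1},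
      monoid.mult = (\<lambda>P Q. \<Union>x\<in>P. \<Union>y\<in>Q. proj_point ring_of_type_algebra (\<lambda>i. x i * y i)),
      one = proj_point ring_of_type_algebra (\<lambda>_. 1)\<rparr>"

definition torus_reduction :: "('k::field \<Rightarrow> real) \<Rightarrow> ('i \<Rightarrow> 'k) set \<Rightarrow> ('i \<Rightarrow> 'k set) set" where
  "torus_reduction v P =
     (\<Union>x\<in>{x \<in> P. \<forall>i. v (x i) = 1}. proj_point (residue_field v) (\<lambda>i. residue v (x i)))"

definition mult_torus :: "('a, 'b) ring_scheme \<Rightarrow> ('i \<Rightarrow> 'a) set set" where
  "mult_torus F = {P \<in> proj_space F. \<forall>x\<in>P. \<forall>i. x i \<noteq> \<zero>\<^bsub>F\<^esub>}"

definition mult_dependent :: "('a, 'b) monoid_scheme \<Rightarrow> ('n::finite \<Rightarrow> 'a) \<Rightarrow> bool" where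
  "mult_dependent G b \<longleftrightarrow>
     (\<exists>l :: 'n \<Rightarrow> int. (\<exists>n. l n \<noteq> 0) \<and> (\<Otimes>\<^bsub>G\<^esub>n\<in>UNIV. b n [^]\<^bsub>G\<^esub> l n) = \<one>\<^bsub>G\<^esub>)"

text \<open>
  From here on the coordinates \<open>x\<^sub>0, \<dots>, x\<^sub>N\<close> are indexed by \<open>'n option\<close> with \<open>N = CARD('n) \<ge> 1\<close>:
  \<open>None\<close> is the index \<open>0\<close>, and \<open>'n\<close> stands for \<open>{1, \<dots>, N}\<close>.
\<close>

definition degenerate :: "('a, 'b) ring_scheme \<Rightarrow> ('n::finite option \<Rightarrow> 'a) set \<Rightarrow> bool" where
  "degenerate F P \<longleftrightarrow>
     (\<exists>b :: 'n \<Rightarrow> 'a. (\<forall>n. b n \<in> Units F) \<and> P = proj_point F (case_option \<one>\<^bsub>F\<^esub> b) \<and>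
       mult_dependent (units_of F) b)"

definition nondegenerate :: "('a, 'b) ring_scheme \<Rightarrow> ('n::finite option \<Rightarrow> 'a) set \<Rightarrow> bool" where
  "nondegenerate F P \<longleftrightarrow> P \<in> mult_torus F \<and> \<not> degenerate F P"


section \<open>Berkovich affine and projective space\<close>

text \<open>Polynomials over \<open>'k\<close> in variables indexed by \<open>'i\<close>, as maps from monomials to coefficients.\<close>

type_synonym ('i, 'k) mpoly = "('i \<Rightarrow>\<^sub>0 nat) \<Rightarrow>\<^sub>0 'k"

abbreviation mconst :: "'k::zero \<Rightarrow> ('i, 'k) mpoly" where
  "mconst c \<equiv> Poly_Mapping.single 0 c"

text \<open>Evaluation at \<open>x\<close> after applying \<open>h\<close> to the coefficients.\<close>

definition mpoly_eval ::
    "('k::zero \<Rightarrow> 'c::comm_ring_1) \<Rightarrow> ('i::finite, 'k) mpoly \<Rightarrow> ('i \<Rightarrow> 'c) \<Rightarrow> 'c" where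
  "mpoly_eval h f x =
     (\<Sum>m\<in>Poly_Mapping.keys f. h (Poly_Mapping.lookup f m) * (\<Prod>i\<in>UNIV. x i ^ Poly_Mapping.lookup m i))"

definition homogeneous :: "nat \<Rightarrow> ('i::finite, 'k::zero) mpoly \<Rightarrow> bool" where
  "homogeneous d f \<longleftrightarrow> (\<forall>m\<in>Poly_Mapping.keys f. (\<Sum>i\<in>UNIV. Poly_Mapping.lookup m i) = d)"

definition berk_affine :: "('k::field \<Rightarrow> real) \<Rightarrow> (('i::finite, 'k) mpoly \<Rightarrow> real) set" where
  "berk_affine v = {\<zeta>. (\<forall>f. 0 \<le> \<zeta> f) \<and> (\<forall>c. \<zeta> (mconst c) = v c) \<and>
     (\<forall>f g. \<zeta> (f + g) \<le> max (\<zeta> f) (\<zeta> g)) \<and> (\<forall>f g. \<zeta> (f * g) = \<zeta> f * \<zeta> g)}"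

definition berk_affine_topology ::
    "('k::field \<Rightarrow> real) \<Rightarrow> (('i::finite, 'k) mpoly \<Rightarrow> real) topology" where
  "berk_affine_topology v =
     topology_generated_by {{\<zeta> \<in> berk_affine v. \<zeta> f \<in> U} | f U. open U}"

definition eval_seminorm ::
    "('k::field \<Rightarrow> real) \<Rightarrow> ('i::finite \<Rightarrow> 'k) \<Rightarrow> ('i, 'k) mpoly \<Rightarrow> real" where
  "eval_seminorm v x = (\<lambda>f. v (mpoly_eval id f x))"

definition berk_punctured :: "('k::field \<Rightarrow> real) \<Rightarrow> (('i::finite, 'k) mpoly \<Rightarrow> real) set" where
  "berk_punctured v = berk_affine v - {eval_seminorm v (\<lambda>_. 0)}"

definition berk_equiv ::
    "('k::field \<Rightarrow> real) \<Rightarrow> (('i::finite, 'k) mpoly \<Rightarrow> real) rel" where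
  "berk_equiv v = {(\<zeta>, \<xi>). \<zeta> \<in> berk_punctured v \<and> \<xi> \<in> berk_punctured v \<and>
     (\<exists>r>0. \<forall>d f. homogeneous d f \<longrightarrow> \<zeta> f = r ^ d * \<xi> f)}"

definition berk_proj :: "('k::field \<Rightarrow> real) \<Rightarrow> (('i::finite, 'k) mpoly \<Rightarrow> real) set set" where
  "berk_proj v = berk_punctured v // berk_equiv v"

definition berk_pi ::
    "('k::field \<Rightarrow> real) \<Rightarrow> (('i::finite, 'k) mpoly \<Rightarrow> real) \<Rightarrow> (('i, 'k) mpoly \<Rightarrow> real) set" where
  "berk_pi v \<zeta> = berk_equiv v `` {\<zeta>}"

definition berk_proj_topology ::
    "('k::field \<Rightarrow> real) \<Rightarrow> (('i::finite, 'k) mpoly \<Rightarrow> real) set topology" where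
  "berk_proj_topology v = topology (\<lambda>U. U \<subseteq> berk_proj v \<and>
     openin (subtopology (berk_affine_topology v) (berk_punctured v))
       {\<zeta> \<in> berk_punctured v. berk_pi v \<zeta> \<in> U})"

definition berk_proj_borel ::
    "('k::field \<Rightarrow> real) \<Rightarrow> (('i::finite, 'k) mpoly \<Rightarrow> real) set measure" where
  "berk_proj_borel v = sigma (berk_proj v) {U. openin (berk_proj_topology v) U}"

definition berk_incl ::
    "('k::field \<Rightarrow> real) \<Rightarrow> ('i::finite \<Rightarrow> 'k) set \<Rightarrow> (('i, 'k) mpoly \<Rightarrow> real) set" where
  "berk_incl v P = (\<Union>x\<in>P. berk_pi v (eval_seminorm v x))"

definition gauss_seminorm ::
    "('c::field \<Rightarrow> real) \<Rightarrow> ('k::field alg_closure \<Rightarrow> 'c) \<Rightarrow> ('i::finite, 'k) mpoly \<Rightarrow> real" where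
  "gauss_seminorm w \<iota> =
     (\<lambda>f. SUP b\<in>{b. \<forall>i. w (b i) \<le> 1}. w (mpoly_eval (\<lambda>c. \<iota> (to_ac c)) f b))"

definition gauss_point ::
    "('k::field \<Rightarrow> real) \<Rightarrow> ('c::field \<Rightarrow> real) \<Rightarrow> ('k alg_closure \<Rightarrow> 'c) \<Rightarrow>
      (('i::finite, 'k) mpoly \<Rightarrow> real) set" where
  "gauss_point v w \<iota> = berk_pi v (gauss_seminorm w \<iota>)"


section \<open>Equidistribution\<close>

text \<open>
  Used for a unit Borel measure \<open>\<mu>\<close> on \<open>T\<close> and nonempty multisets \<open>Z l\<close> of points of \<open>T\<close>.
\<close>

definition equidistributed :: "'a topology \<Rightarrow> 'a measure \<Rightarrow> (nat \<Rightarrow> 'a multiset) \<Rightarrow> bool" where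
  "equidistributed T \<mu> Z \<longleftrightarrow>
     (\<forall>\<phi>. continuous_map T euclideanreal \<phi> \<longrightarrow>
       (\<lambda>l. (\<Sum>z\<in>#Z l. \<phi> z) / real (size (Z l))) \<longlonglongrightarrow> (\<integral>z. \<phi> z \<partial>\<mu>))"


section \<open>Well-definedness\<close>

lemma topspace_berk_affine [simp]:
  fixes v :: "'k::field \<Rightarrow> real"
  shows "topspace (berk_affine_topology v) =
    (berk_affine v :: (('i::finite, 'k) mpoly \<Rightarrow> real) set)"
proof -
  have "berk_affine v \<subseteq> \<Union> {{\<zeta> \<in> berk_affine v. \<zeta> f \<in> U} | (f :: ('i, 'k) mpoly) U. open U}"
  proof
    fix \<zeta> :: "('i, 'k) mpoly \<Rightarrow> real" assume "\<zeta> \<in> berk_affine v"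
    then have "\<zeta> \<in> {\<zeta> \<in> berk_affine v. \<zeta> 0 \<in> UNIV}" by simp
    then show "\<zeta> \<in> \<Union> {{\<zeta> \<in> berk_affine v. \<zeta> f \<in> U} | f U. open U}"
      using open_UNIV by blast
  qed
  then show ?thesis
    unfolding berk_affine_topology_def by auto
qed

lemma equiv_berk_equiv:
  fixes v :: "'k::field \<Rightarrow> real"
  shows "equiv (berk_punctured v) (berk_equiv v :: (('i::finite, 'k) mpoly \<Rightarrow> real) rel)"
proof (rule equivI)
  let ?R = "berk_equiv v :: (('i, 'k) mpoly \<Rightarrow> real) rel"
  show "?R \<subseteq> berk_punctured v \<times> berk_punctured v"
    by (auto simp: berk_equiv_def)
  show "refl_on (berk_punctured v) ?R"
    by (auto simp: refl_on_def berk_equiv_def intro!: exI[of _ 1])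
  show "sym ?R"
  proof (rule symI)
    fix \<zeta> \<xi> assume "(\<zeta>, \<xi>) \<in> ?R"
    then obtain r where r: "r > 0" "\<forall>d f. homogeneous d f \<longrightarrow> \<zeta> f = r ^ d * \<xi> f"
      and *: "\<zeta> \<in> berk_punctured v" "\<xi> \<in> berk_punctured v"
      by (auto simp: berk_equiv_def)
    have "\<forall>d f. homogeneous d f \<longrightarrow> \<xi> f = inverse r ^ d * \<zeta> f"
      using r by (auto simp: power_inverse)
    with r * show "(\<xi>, \<zeta>) \<in> ?R"
      by (auto simp: berk_equiv_def intro!: exI[of _ "inverse r"])
  qed
  show "trans ?R"
  proof (rule transI)
    fix \<zeta> \<xi> \<eta> assume "(\<zeta>, \<xi>) \<in> ?R" "(\<xi>, \<eta>) \<in> ?R"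
    then have *: "\<zeta> \<in> berk_punctured v" "\<eta> \<in> berk_punctured v"
      and "\<exists>r>0. \<forall>d f. homogeneous d f \<longrightarrow> \<zeta> f = r ^ d * \<xi> f"
      and "\<exists>s>0. \<forall>d f. homogeneous d f \<longrightarrow> \<xi> f = s ^ d * \<eta> f"
      by (simp_all add: berk_equiv_def)
    then obtain r s :: real where "r > 0" "s > 0"
      and r: "\<And>d f. homogeneous d f \<Longrightarrow> \<zeta> f = r ^ d * \<xi> f"
      and s: "\<And>d f. homogeneous d f \<Longrightarrow> \<xi> f = s ^ d * \<eta> f"
      by meson
    then have "r * s > 0" by simp
    moreover have "\<forall>d f. homogeneous d f \<longrightarrow> \<zeta> f = (r * s) ^ d * \<eta> f"
      using r s by (simp add: power_mult_distrib mult.assoc)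
    ultimately have "\<exists>t>0. \<forall>d f. homogeneous d f \<longrightarrow> \<zeta> f = t ^ d * \<eta> f" by blast
    with * show "(\<zeta>, \<eta>) \<in> ?R"
      by (simp add: berk_equiv_def)
  qed
qed

lemma openin_berk_proj:
  fixes v :: "'k::field \<Rightarrow> real" and U :: "(('i::finite, 'k) mpoly \<Rightarrow> real) set set"
  shows "openin (berk_proj_topology v) U \<longleftrightarrow> U \<subseteq> berk_proj v \<and>
     openin (subtopology (berk_affine_topology v) (berk_punctured v))
       {\<zeta> \<in> berk_punctured v. berk_pi v \<zeta> \<in> U}"
proof -
  let ?X = "subtopology (berk_affine_topology v) (berk_punctured v)"
  let ?pre = "\<lambda>U :: (('i, 'k) mpoly \<Rightarrow> real) set set. {\<zeta> \<in> berk_punctured v. berk_pi v \<zeta> \<in> U}"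
  have "istopology (\<lambda>U. U \<subseteq> berk_proj v \<and> openin ?X (?pre U))"
    unfolding istopology_def
  proof (rule conjI; intro allI impI)
    fix S T assume *: "S \<subseteq> berk_proj v \<and> openin ?X (?pre S)" "T \<subseteq> berk_proj v \<and> openin ?X (?pre T)"
    have "?pre (S \<inter> T) = ?pre S \<inter> ?pre T" by auto
    with * show "S \<inter> T \<subseteq> berk_proj v \<and> openin ?X (?pre (S \<inter> T))" by auto
  next
    fix \<K> assume *: "\<forall>K\<in>\<K>. K \<subseteq> berk_proj v \<and> openin ?X (?pre K)"
    have "?pre (\<Union>\<K>) = (\<Union>K\<in>\<K>. ?pre K)" by auto
    with * show "\<Union>\<K> \<subseteq> berk_proj v \<and> openin ?X (?pre (\<Union>\<K>))" by auto
  qed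
  then show ?thesis
    by (simp add: berk_proj_topology_def topology_inverse')
qed

lemma topspace_berk_proj [simp]:
  fixes v :: "'k::field \<Rightarrow> real"
  shows "topspace (berk_proj_topology v) =
    (berk_proj v :: (('i::finite, 'k) mpoly \<Rightarrow> real) set set)"
proof (rule subset_antisym)
  let ?T = "berk_proj_topology v :: (('i, 'k) mpoly \<Rightarrow> real) set topology"
  show "topspace ?T \<subseteq> berk_proj v"
    using openin_topspace[of ?T] unfolding openin_berk_proj by (rule conjunct1)
  have *: "{\<zeta> \<in> berk_punctured v. berk_pi v \<zeta> \<in> berk_proj v} =
      topspace (subtopology (berk_affine_topology v)
        (berk_punctured v :: (('i, 'k) mpoly \<Rightarrow> real) set))"
    by (auto simp: berk_proj_def berk_pi_def quotientI berk_punctured_def)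
  have "openin ?T (berk_proj v)"
    unfolding openin_berk_proj * by (intro conjI subset_refl openin_topspace)
  then show "berk_proj v \<subseteq> topspace ?T"
    by (rule openin_subset)
qed

lemma quotient_map_berk_pi:
  "quotient_map (subtopology (berk_affine_topology v) (berk_punctured v))
     (berk_proj_topology v) (berk_pi v)"
proof -
  have *: "topspace (subtopology (berk_affine_topology v) (berk_punctured v)) = berk_punctured v"
    by (auto simp: berk_punctured_def)
  show ?thesis
    unfolding quotient_map_def * topspace_berk_proj openin_berk_proj
    by (auto simp: berk_proj_def berk_pi_def quotient_def)
qed

lemma proj_point_type_eq:
  "proj_point ring_of_type_algebra x = {\<lambda>i. c * x i | c. c \<noteq> (0::'k::field)}"
proof -
  have "field (ring_of_type_algebra :: 'k ring)"
    by (rule field_from_type_algebra)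
  then have "Units (ring_of_type_algebra :: 'k ring) = {c. c \<noteq> 0}"
    by (auto simp: field.field_Units ring_of_type_algebra_def)
  then show ?thesis
    by (simp add: proj_point_def) (simp add: ring_of_type_algebra_def)
qed

lemma proj_point_type_scale:
  assumes "c \<noteq> (0::'k::field)"
  shows "proj_point ring_of_type_algebra (\<lambda>i. c * x i) = proj_point ring_of_type_algebra x"
  unfolding proj_point_type_eq
proof (intro equalityI subsetI)
  fix y assume "y \<in> {\<lambda>i. d * (c * x i) | d. d \<noteq> 0}"
  then obtain d where "d \<noteq> 0" "y = (\<lambda>i. (d * c) * x i)" by (auto simp: mult.assoc)
  with assms show "y \<in> {\<lambda>i. d * x i | d. d \<noteq> 0}" by (auto intro!: exI[of _ "d * c"])
next
  fix y assume "y \<in> {\<lambda>i. d * x i | d. d \<noteq> 0}"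
  then obtain d where "d \<noteq> 0" "y = (\<lambda>i. (d / c) * (c * x i))" using assms by auto
  with assms show "y \<in> {\<lambda>i. d * (c * x i) | d. d \<noteq> 0}" by (auto intro!: exI[of _ "d / c"])
qed

lemma unit_torus_mult:
  fixes x y :: "'i \<Rightarrow> 'k::field"
  shows "proj_point ring_of_type_algebra x \<otimes>\<^bsub>unit_torus v\<^esub> proj_point ring_of_type_algebra y =
     proj_point ring_of_type_algebra (\<lambda>i. x i * y i)"
proof -
  let ?p = "proj_point (ring_of_type_algebra :: 'k ring)"
  have *: "?p (\<lambda>i. (c * x i) * (d * y i)) = ?p (\<lambda>i. x i * y i)" if "c \<noteq> 0" "d \<noteq> 0" for c d
    using proj_point_type_scale[of "c * d" "\<lambda>i. x i * y i"] that by (simp add: mult_ac)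
  have in_p: "x \<in> ?p x" for x :: "'i \<Rightarrow> 'k"
    unfolding proj_point_type_eq by (auto intro!: exI[of _ 1])
  have "?p (\<lambda>i. x' i * y' i) = ?p (\<lambda>i. x i * y i)" if "x' \<in> ?p x" "y' \<in> ?p y" for x' y'
    using that * unfolding proj_point_type_eq[of x] proj_point_type_eq[of y] by auto
  then have "(\<Union>x'\<in>?p x. \<Union>y'\<in>?p y. ?p (\<lambda>i. x' i * y' i)) = ?p (\<lambda>i. x i * y i)"
    using in_p[of x] in_p[of y] by blast
  then show ?thesis
    by (simp add: unit_torus_def)
qed

lemma unit_torus_pow:
  "proj_point ring_of_type_algebra x [^]\<^bsub>unit_torus v\<^esub> (n::nat) =
     proj_point ring_of_type_algebra (\<lambda>i. (x i :: 'k::field) ^ n)"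
proof (induction n)
  case 0
  show ?case by (simp add: nat_pow_def) (simp add: unit_torus_def)
next
  case (Suc n)
  then show ?case by (simp add: nat_pow_Suc unit_torus_mult mult.commute)
qed

end

theory Submission
  imports Defs
begin

text \<open>
  Let \<open>a = (1 : y\<^sub>1 : \<dots> : y\<^sub>N)\<close> with all \<open>\<bar>y\<^sub>n\<bar> = 1\<close>, and write \<open>x = (1, y\<^sub>1, \<dots>, y\<^sub>N)\<close>. For a
  polynomial \<open>f\<close> with coefficients \<open>c\<^sub>m\<close>, the value \<open>f (x\<^sup>j) = (\<Sum>m. c\<^sub>m (x\<^sup>m)\<^sup>j)\<close> is a power sum in
  \<open>j\<close>. Degeneracy of the reduction of \<open>a\<close> means that some \<open>u = (\<Prod>n. y\<^sub>n powi l\<^sub>n)\<close> with \<open>l \<noteq> 0\<close> satisfies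
  \<open>\<bar>u - 1\<bar> < 1\<close> (\<open>nondegenerate_reduction_iff\<close>).

  Suppose that there is no such relation. Then distinct values of monomials at \<open>x\<close>, and also their
  \<open>d\<close>-th powers for every \<open>d > 0\<close>, stay distinct in the residue field. The heart of the proof is
  \<open>power_sum_generic_abs\<close>: for such bases the absolute value of a power sum is the maximum of the
  absolute values of its coefficients, for all \<open>j\<close> outside a set of natural density zero. The theorem
  of Skolem, Mahler and Lech would give a finite exceptional set for the reduced sum; for density zero
  there is an elementary argument. A set \<open>S\<close> has density zero as soon as \<open>S \<inter> (S - d)\<close> has, for every
  \<open>d > 0\<close> (\<open>density_zero_of_shifts\<close>), and at a \<open>j\<close> with \<open>j, j + d \<in> S\<close> subtracting the two sums
  eliminates one of the bases.

  Consequently every \<open>f\<close> has a value \<open>[f]\<close> with \<open>\<bar>f (x\<^sup>j)\<bar> = [f]\<close> for almost all \<open>j\<close> in the sense of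
  density. Finitely many such statements hold simultaneously at some \<open>j\<close>, so \<open>f \<mapsto> [f]\<close> inherits the
  axioms of a point of Berkovich affine space from the points \<open>x\<^sup>j\<close>. On homogeneous polynomials it is
  the Gauss norm, so it lies over the Gauss point. A continuous function on projective space,
  pulled back to affine space, is bounded on a compact set that contains all the \<open>x\<^sup>j\<close> and the limit, and
  it is close to its value at the limit for almost all \<open>j\<close>; hence its averages converge to that value
  (\<open>generic_powers_equidistribute\<close>). The same limit construction, applied to a vector of distinct
  prime numbers, shows that the Gauss norm is multiplicative and that it agrees with the supremum
  over the unit polydisc; this is where residue characteristic zero enters
  (\<open>gauss_norm_in_berk_affine\<close>, \<open>gauss_seminorm_eq_gauss_norm\<close>).

  Conversely, clearing denominators in a relation \<open>\<bar>u - 1\<bar> < 1\<close> gives a homogeneous binomial \<open>f\<close> of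
  degree \<open>D\<close> and Gauss norm one such that \<open>\<bar>f (x\<^sup>j)\<bar> = \<bar>u\<^sup>j - 1\<bar> \<le> \<bar>u - 1\<bar>\<close> for all \<open>j\<close>. The function
  \<open>\<zeta> \<mapsto> [f]\<^sub>\<zeta> / (\<Sum>i. [X\<^sub>i]\<^sub>\<zeta>)\<^sup>D\<close> is continuous on projective space and separates the averages from the
  Gauss point.
\<close>

section \<open>Sets of natural density zero\<close>

definition density_zero :: "nat set \<Rightarrow> bool" where
  "density_zero S \<longleftrightarrow> (\<lambda>n. real (card (S \<inter> {1..n})) / real n) \<longlonglongrightarrow> 0"

lemma density_zeroI:
  assumes "\<And>e. e > 0 \<Longrightarrow> \<exists>n0. \<forall>n\<ge>n0. real (card (S \<inter> {1..n})) \<le> e * real n"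
  shows "density_zero S"
  unfolding density_zero_def
proof (rule LIMSEQ_I)
  fix r :: real assume "r > 0"
  then obtain n0 where n0: "\<forall>n\<ge>n0. real (card (S \<inter> {1..n})) \<le> r/2 * real n"
    using assms[of "r/2"] by auto
  show "\<exists>no. \<forall>n\<ge>no. norm (real (card (S \<inter> {1..n})) / real n - 0) < r"
  proof (intro exI allI impI)
    fix n assume n: "n \<ge> Suc n0"
    then have "real (card (S \<inter> {1..n})) \<le> r/2 * real n" using n0 by simp
    also have "\<dots> < r * real n" using n \<open>r > 0\<close> by simp
    finally show "norm (real (card (S \<inter> {1..n})) / real n - 0) < r"
      using n by (simp add: divide_less_eq)
  qed
qed

lemma density_zeroD:
  assumes "density_zero S" "e > 0"
  shows "\<exists>n0. \<forall>n\<ge>n0. real (card (S \<inter> {1..n})) \<le> e * real n"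
proof -
  from LIMSEQ_D[OF assms(1)[unfolded density_zero_def] assms(2)]
  obtain n0 where n0: "\<forall>n\<ge>n0. real (card (S \<inter> {1..n})) / real n < e" by auto
  have "real (card (S \<inter> {1..n})) \<le> e * real n" if "n \<ge> n0" for n
    using n0[rule_format, OF that] by (cases "n = 0") (auto simp: divide_less_eq)
  then show ?thesis by blast
qed

lemma density_zero_empty [simp]: "density_zero {}"
  by (simp add: density_zero_def)

lemma density_zero_subset:
  assumes "density_zero T" "S \<subseteq> T"
  shows "density_zero S"
proof (rule density_zeroI)
  fix e :: real assume "e > 0"
  then obtain n0 where "\<forall>n\<ge>n0. real (card (T \<inter> {1..n})) \<le> e * real n"
    using density_zeroD[OF assms(1)] by blast
  moreover have "card (S \<inter> {1..n}) \<le> card (T \<inter> {1..n})" for n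
    using assms(2) by (intro card_mono) auto
  ultimately show "\<exists>n0. \<forall>n\<ge>n0. real (card (S \<inter> {1..n})) \<le> e * real n"
    by (meson of_nat_le_iff order_trans)
qed

lemma density_zero_Un:
  assumes "density_zero S" "density_zero T"
  shows "density_zero (S \<union> T)"
proof (rule density_zeroI)
  fix e :: real assume "e > 0"
  then have "e/2 > 0" by simp
  obtain n1 where n1: "\<forall>n\<ge>n1. real (card (S \<inter> {1..n})) \<le> e/2 * real n"
    using density_zeroD[OF assms(1) \<open>e/2 > 0\<close>] by blast
  obtain n2 where n2: "\<forall>n\<ge>n2. real (card (T \<inter> {1..n})) \<le> e/2 * real n"
    using density_zeroD[OF assms(2) \<open>e/2 > 0\<close>] by blast
  have "real (card ((S \<union> T) \<inter> {1..n})) \<le> e * real n" if "n \<ge> max n1 n2" for n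
  proof -
    have "card ((S \<union> T) \<inter> {1..n}) \<le> card (S \<inter> {1..n}) + card (T \<inter> {1..n})"
      by (simp add: Int_Un_distrib2 card_Un_le)
    then have "real (card ((S \<union> T) \<inter> {1..n})) \<le> real (card (S \<inter> {1..n})) + real (card (T \<inter> {1..n}))"
      by linarith
    also have "\<dots> \<le> e/2 * real n + e/2 * real n"
      using n1 n2 that by (intro add_mono) auto
    finally show ?thesis by simp
  qed
  then show "\<exists>n0. \<forall>n\<ge>n0. real (card ((S \<union> T) \<inter> {1..n})) \<le> e * real n" by blast
qed

lemma not_density_zero_UNIV: "\<not> density_zero UNIV"
proof
  assume "density_zero UNIV"
  then obtain n0 where "\<forall>n\<ge>n0. real (card (UNIV \<inter> {1..n})) \<le> 1/2 * real n"
    using density_zeroD[of UNIV "1/2"] by auto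
  then show False by (auto dest!: spec[of _ "Suc n0"])
qed

lemma density_zero_avoid:
  assumes "density_zero S" shows "\<exists>j. j \<notin> S"
  using assms not_density_zero_UNIV by (metis UNIV_eq_I)

text \<open>
  Let \<open>P\<close> collect the \<open>j \<in> S\<close> that have another element of \<open>S\<close> at distance less than \<open>M\<close> above them; it
  has density zero by hypothesis. The translates of \<open>S - P\<close> by \<open>0, \<dots>, M - 1\<close> are disjoint, so the
  density of \<open>S - P\<close> is at most \<open>1 / M\<close>.
\<close>
lemma density_zero_of_shifts:
  assumes "\<And>d. d > 0 \<Longrightarrow> density_zero {j \<in> S. j + d \<in> S}"
  shows "density_zero S"
proof (rule density_zeroI)
  fix e :: real assume e: "e > 0"
  \<comment> \<open>The set \<open>S - P\<close> will have density at most \<open>1 / M < e / 2\<close>; of the rest, \<open>e / 4\<close> goes to \<open>P\<close> and \<open>e / 4\<close> to the boundary term.\<close>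
  obtain M :: nat where M: "real M > 2 / e" using reals_Archimedean2 by blast
  then have Mpos: "M > 0" using e by (auto intro!: Nat.gr0I simp: not_less divide_le_0_iff)
  have Me: "2 < e * real M" using M e by (simp add: divide_less_eq mult.commute)
  define P where "P = (\<Union>d\<in>{1..<M}. {j \<in> S. j + d \<in> S})"
  have P: "density_zero P"
  proof -
    have "density_zero (\<Union>d\<in>D. {j \<in> S. j + d \<in> S})" if "finite D" "\<forall>d\<in>D. d > 0" for D
      using that
    proof (induction D rule: finite_induct)
      case (insert d D)
      have "density_zero {j \<in> S. j + d \<in> S}" using assms insert.prems by blast
      moreover have "density_zero (\<Union>d\<in>D. {j \<in> S. j + d \<in> S})" using insert by auto
      ultimately have "density_zero ({j \<in> S. j + d \<in> S} \<union> (\<Union>d\<in>D. {j \<in> S. j + d \<in> S}))" by (rule density_zero_Un)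
      then show ?case by simp
    qed simp
    then show ?thesis unfolding P_def by auto
  qed
  have count: "real (card ((S - P) \<inter> {1..n})) * real M \<le> real n + real M" for n
  proof -
    let ?G = "(S - P) \<inter> {1..n}"
    have inj: "inj_on (\<lambda>(j, i). j + i) (?G \<times> {..<M})"
    proof -
      have False if "j \<in> ?G" "j' \<in> ?G" "i < M" "i' < M" "j + i = j' + i'" "j < j'" for j j' i i'
      proof -
        have "j + (j' - j) = j'" "j' - j \<in> {1..<M}" using that by auto
        then have "j \<in> P" unfolding P_def using that by (intro UN_I[of "j' - j"]) auto
        then show False using that by auto
      qed
      note F = this
      show ?thesis
      proof (rule inj_onI, clarsimp)
        fix j i j' i'
        assume *: "j + i = j' + (i' :: nat)" "j \<in> S" "j \<notin> P" "j' \<in> S" "j' \<notin> P" "i < M" "i' < M"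
          "Suc 0 \<le> j" "j \<le> n" "Suc 0 \<le> j'" "j' \<le> n"
        then have "j \<in> ?G" "j' \<in> ?G" by auto
        then have "\<not> j < j'" "\<not> j' < j" using F[of j j' i i'] F[of j' j i' i] * by auto
        then show "j = j' \<and> i = i'" using * by auto
      qed
    qed
    \<comment> \<open>The \<open>M\<close> disjoint translates of the set all lie in \<open>{1..n + M}\<close>.\<close>
    have "card ?G * M = card ((\<lambda>(j, i). j + i) ` (?G \<times> {..<M}))"
      by (subst card_image[OF inj]) (simp add: card_cartesian_product)
    also have "\<dots> \<le> card {1..n + M}"
      by (intro card_mono) auto
    finally have "card ?G * M \<le> n + M" by simp
    then have "real (card ?G * M) \<le> real (n + M)" by (rule of_nat_mono)
    then show ?thesis by simp
  qed
  obtain n1 where n1: "\<forall>n\<ge>n1. real (card (P \<inter> {1..n})) \<le> e/4 * real n"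
    using density_zeroD[OF P, of "e/4"] e by auto
  obtain n2 :: nat where n2: "real n2 > 4 / e" using reals_Archimedean2 by blast
  show "\<exists>n0. \<forall>n\<ge>n0. real (card (S \<inter> {1..n})) \<le> e * real n"
  proof (intro exI allI impI)
    fix n assume n: "n \<ge> max n1 n2"
    have "card (S \<inter> {1..n}) \<le> card ((S - P) \<inter> {1..n} \<union> P \<inter> {1..n})"
      by (intro card_mono) auto
    also have "\<dots> \<le> card ((S - P) \<inter> {1..n}) + card (P \<inter> {1..n})" by (rule card_Un_le)
    finally have A: "real (card (S \<inter> {1..n})) \<le> real (card ((S - P) \<inter> {1..n})) + real (card (P \<inter> {1..n}))"
      by linarith
    have "real (card ((S - P) \<inter> {1..n})) \<le> real n / real M + 1"
      using count[of n] Mpos by (simp add: field_simps)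
    also have "real n / real M \<le> e/2 * real n"
    proof -
      have "1 / real M \<le> e / 2" using Me Mpos by (simp add: field_simps)
      then have "real n * (1 / real M) \<le> real n * (e/2)" by (rule mult_left_mono) simp
      then show ?thesis by (simp add: mult.commute)
    qed
    also have "1 \<le> e/4 * real n"
    proof -
      have "real n > 4/e" using n2 n by linarith
      then show ?thesis using e by (simp add: field_simps)
    qed
    finally have B: "real (card ((S - P) \<inter> {1..n})) \<le> e/2 * real n + e/4 * real n" by simp
    have "real (card (P \<inter> {1..n})) \<le> e/4 * real n" using n1 n by auto
    with A B show "real (card (S \<inter> {1..n})) \<le> e * real n" by argo
  qed
qed

text \<open>
  The indices where \<open>g\<close> is not close to \<open>L\<close> contribute at most their proportion times a bound of
  \<open>\<bar>g j - L\<bar>\<close>.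
\<close>
lemma averages_tendsto:
  fixes g :: "nat \<Rightarrow> real"
  assumes bound: "\<And>j. \<bar>g j\<bar> \<le> B"
    and near: "\<And>e. e > 0 \<Longrightarrow> density_zero {j. \<not> \<bar>g j - L\<bar> < e}"
  shows "(\<lambda>l. (\<Sum>j\<in>{1..Suc l}. g j) / real (Suc l)) \<longlonglongrightarrow> L"
proof (rule LIMSEQ_I)
  fix r :: real assume r: "r > 0"
  define C where "C = B + \<bar>L\<bar> + 1"
  have C: "\<bar>g j - L\<bar> \<le> C" for j using bound[of j] unfolding C_def by linarith
  have Cpos: "C > 0" using bound[of 0] unfolding C_def by linarith
  let ?S = "{j. \<not> \<bar>g j - L\<bar> < r/2}"
  have "r / (4 * C) > 0" using r Cpos by simp
  with density_zeroD[OF near[of "r/2"]] r obtain n0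
    where n0: "\<forall>n\<ge>n0. real (card (?S \<inter> {1..n})) \<le> r/(4*C) * real n" by (metis half_gt_zero)
  show "\<exists>no. \<forall>n\<ge>no. norm ((\<Sum>j\<in>{1..Suc n}. g j) / real (Suc n) - L) < r"
  proof (intro exI allI impI)
    fix l assume l: "l \<ge> n0"
    define n where "n = Suc l"
    have npos: "real n > 0" by (simp add: n_def)
    have "\<bar>(\<Sum>j\<in>{1..n}. g j) - real n * L\<bar> = \<bar>\<Sum>j\<in>{1..n}. (g j - L)\<bar>"
      by (simp add: sum_subtractf)
    also have "\<dots> \<le> (\<Sum>j\<in>{1..n}. \<bar>g j - L\<bar>)" by (rule sum_abs)
    also have "\<dots> \<le> (\<Sum>j\<in>{1..n}. r/2 + (if j \<in> ?S then C else 0))"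
    proof (rule sum_mono)
      fix j
      show "\<bar>g j - L\<bar> \<le> r/2 + (if j \<in> ?S then C else 0)" using C[of j] r by auto
    qed
    also have "\<dots> = real n * (r/2) + C * real (card (?S \<inter> {1..n}))"
      by (simp add: sum.distrib sum.If_cases Int_commute mult.commute)
    also have "C * real (card (?S \<inter> {1..n})) \<le> C * (r/(4*C) * real n)"
      using n0[rule_format, of n] l Cpos by (intro mult_left_mono) (simp_all only: n_def le_SucI less_imp_le)
    also have "C * (r/(4*C) * real n) = r/4 * real n" using Cpos by simp
    finally have "\<bar>(\<Sum>j\<in>{1..n}. g j) - real n * L\<bar> \<le> 3/4 * r * real n" by (simp add: algebra_simps)
    moreover have "3/4 * r * real n < r * real n" using npos r by simp
    ultimately have "\<bar>(\<Sum>j\<in>{1..n}. g j) - real n * L\<bar> < r * real n" by linarith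
    moreover have "(\<Sum>j\<in>{1..n}. g j) / real n - L = ((\<Sum>j\<in>{1..n}. g j) - real n * L) / real n"
      using npos by (simp add: field_simps)
    ultimately have "\<bar>(\<Sum>j\<in>{1..n}. g j) / real n - L\<bar> < r" using npos
      by (simp add: abs_divide divide_less_eq)
    then show "norm ((\<Sum>j\<in>{1..Suc l}. g j) / real (Suc l) - L) < r"
      unfolding n_def real_norm_def .
  qed
qed

section \<open>Power sums over a non-archimedean valued field\<close>

locale valued_field =
  fixes v :: "'k::field \<Rightarrow> real"
  assumes nonarch: "nonarch_abs v"
begin

lemma abs_nonneg [simp]: "0 \<le> v x"
  and abs_eq_0 [simp]: "v x = 0 \<longleftrightarrow> x = 0"
  and abs_mult: "v (x * y) = v x * v y"
  and abs_add_le: "v (x + y) \<le> max (v x) (v y)"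
  using nonarch unfolding nonarch_abs_def by blast+

lemma abs_zero [simp]: "v 0 = 0" using abs_eq_0 by blast

lemma abs_one [simp]: "v 1 = 1"
  using abs_mult[of 1 1] abs_eq_0[of 1] by auto

lemma abs_power: "v (x ^ n) = v x ^ n"
  by (induction n) (auto simp: abs_mult)

lemma abs_prod: "v (prod f A) = (\<Prod>i\<in>A. v (f i))"
  by (induction A rule: infinite_finite_induct) (auto simp: abs_mult)

lemma abs_inverse: "v (inverse x) = inverse (v x)"
proof (cases "x = 0")
  case False
  then have "v x * v (inverse x) = 1" by (simp flip: abs_mult)
  then show ?thesis by (metis inverse_unique)
qed simp

lemma abs_powi: "v (x powi n) = v x powi n"
  by (simp add: power_int_def abs_power abs_inverse)

lemma abs_minus [simp]: "v (- x) = v x"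
proof -
  have "v (-1) ^ 2 = 1" by (simp flip: abs_power)
  then have "v (-1) = 1" using abs_nonneg[of "-1"] by (auto simp: power2_eq_1_iff)
  then show ?thesis using abs_mult[of "-1" x] by simp
qed

lemma abs_diff_le: "v (x - y) \<le> max (v x) (v y)"
  using abs_add_le[of x "- y"] by simp

lemma abs_diff_commute: "v (x - y) = v (y - x)"
  using abs_minus[of "x - y"] by simp

lemma abs_add_eq_left:
  assumes "v y < v x" shows "v (x + y) = v x"
proof -
  have "v x \<le> max (v (x + y)) (v y)" using abs_diff_le[of "x + y" y] by simp
  moreover have "v (x + y) \<le> max (v x) (v y)" by (rule abs_add_le)
  ultimately show ?thesis using assms by auto
qed

lemma abs_add_less: "v x < r \<Longrightarrow> v y < r \<Longrightarrow> v (x + y) < r"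
  using abs_add_le[of x y] by linarith

lemma abs_diff_less: "v x < r \<Longrightarrow> v y < r \<Longrightarrow> v (x - y) < r"
  using abs_diff_le[of x y] by linarith

lemma abs_sum_le:
  assumes "0 \<le> B" "\<And>i. i \<in> A \<Longrightarrow> v (f i) \<le> B"
  shows "v (sum f A) \<le> B"
  using assms(2)
proof (induction A rule: infinite_finite_induct)
  case (insert i A)
  have "v (sum f (insert i A)) \<le> max (v (f i)) (v (sum f A))" using insert abs_add_le by simp
  then show ?case using insert by fastforce
qed (use assms(1) in auto)

lemma abs_sum_less:
  assumes "0 < B" "\<And>i. i \<in> A \<Longrightarrow> v (f i) < B"
  shows "v (sum f A) < B"
  using assms(2)
proof (induction A rule: infinite_finite_induct)
  case (insert i A)
  then show ?case using abs_add_less by simp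
qed (use assms(1) in auto)

text \<open>
  Induction on the number of terms. If the coefficient of \<open>m0\<close> is small, that term can be dropped.
  If it is the only coefficient of absolute value one, it dominates the sum. Otherwise, let \<open>S\<close> be the
  exceptional set and \<open>j, j + d \<in> S\<close>: the combination \<open>s (j + d) - \<alpha> m0 ^ d * s j\<close> of two small sums is
  small and has no \<open>m0\<close>-term, while its other coefficients have kept their absolute values. So
  \<open>S \<inter> (S - d)\<close> has density zero by induction, and then so has \<open>S\<close>.
\<close>
lemma power_sum_normalised:
  assumes "finite M"
    and "\<And>m. m \<in> M \<Longrightarrow> v (\<alpha> m) = 1"
    and "\<And>m m' d. m \<in> M \<Longrightarrow> m' \<in> M \<Longrightarrow> m \<noteq> m' \<Longrightarrow> 0 < (d::nat) \<Longrightarrow> v (\<alpha> m ^ d - \<alpha> m' ^ d) = 1"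
    and "\<And>m. m \<in> M \<Longrightarrow> v (C m) \<le> 1" and "\<exists>m\<in>M. v (C m) = 1"
  shows "density_zero {j. v (\<Sum>m\<in>M. C m * \<alpha> m ^ j) < 1}"
  using assms
proof (induction M arbitrary: C rule: finite_induct)
  case empty
  then show ?case by simp
next
  case (insert m0 F)
  have IH: "density_zero {j. v (\<Sum>m\<in>F. D m * \<alpha> m ^ j) < 1}"
    if "\<And>m. m \<in> F \<Longrightarrow> v (D m) \<le> 1" "\<exists>m\<in>F. v (D m) = 1" for D
    using insert.IH[of D] insert.prems that by blast
  let ?S = "{j. v (\<Sum>m\<in>insert m0 F. C m * \<alpha> m ^ j) < 1}"
  have split: "(\<Sum>m\<in>insert m0 F. C m * \<alpha> m ^ j) = C m0 * \<alpha> m0 ^ j + (\<Sum>m\<in>F. C m * \<alpha> m ^ j)" for j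
    using insert.hyps by simp
  have unit: "v (x * \<alpha> m ^ j) = v x" if "m \<in> insert m0 F" for x m j
    using insert.prems(1)[OF that] by (simp add: abs_mult abs_power)
  show ?case
  proof (cases "v (C m0) < 1")
    case True
    have "v (\<Sum>m\<in>F. C m * \<alpha> m ^ j) < 1" if "j \<in> ?S" for j
    proof -
      have "v (C m0 * \<alpha> m0 ^ j) < 1" using True by (simp add: unit)
      with that abs_diff_less[of "\<Sum>m\<in>insert m0 F. C m * \<alpha> m ^ j" 1 "C m0 * \<alpha> m0 ^ j"]
      show ?thesis unfolding split by simp
    qed
    then have "?S \<subseteq> {j. v (\<Sum>m\<in>F. C m * \<alpha> m ^ j) < 1}" by blast
    moreover have "\<exists>m\<in>F. v (C m) = 1" using insert.prems(4) True by auto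
    moreover have "density_zero {j. v (\<Sum>m\<in>F. C m * \<alpha> m ^ j) < 1}"
      using insert.prems(3) calculation(2) by (intro IH) auto
    ultimately show ?thesis by (blast intro: density_zero_subset)
  next
    case False
    then have C0: "v (C m0) = 1" using insert.prems(3)[of m0] by simp
    show ?thesis
    proof (cases "\<exists>m\<in>F. v (C m) = 1")
      case False
      have "v (\<Sum>m\<in>insert m0 F. C m * \<alpha> m ^ j) = 1" for j
      proof -
        have "v (\<Sum>m\<in>F. C m * \<alpha> m ^ j) < 1"
        proof (rule abs_sum_less)
          fix m assume "m \<in> F"
          then show "v (C m * \<alpha> m ^ j) < 1"
            using False insert.prems(3)[of m] by (simp add: unit) fastforce
        qed simp
        then show ?thesis unfolding split using C0 abs_add_eq_left by (simp add: unit)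
      qed
      then show ?thesis by simp
    next
      case True
      show ?thesis
      proof (rule density_zero_of_shifts)
        fix d :: nat assume d: "d > 0"
        define D where "D m = C m * (\<alpha> m ^ d - \<alpha> m0 ^ d)" for m
        have vD: "v (D m) = v (C m)" if "m \<in> F" for m
          using insert.prems(2)[of m m0 d] that insert.hyps d by (auto simp: D_def abs_mult)
        have "v (\<Sum>m\<in>F. D m * \<alpha> m ^ j) < 1" if "j \<in> ?S" "j + d \<in> ?S" for j
        proof -
          \<comment> \<open>Subtracting \<open>\<alpha> m0 ^ d\<close> times the sum at \<open>j\<close> from the sum at \<open>j + d\<close> cancels \<open>m0\<close>.\<close>
          have "(\<Sum>m\<in>F. D m * \<alpha> m ^ j) = (\<Sum>m\<in>insert m0 F. C m * \<alpha> m ^ (j + d))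
              - \<alpha> m0 ^ d * (\<Sum>m\<in>insert m0 F. C m * \<alpha> m ^ j)"
            unfolding split D_def
            by (simp add: algebra_simps power_add sum_subtractf sum_distrib_left)
          moreover have "v (\<alpha> m0 ^ d * (\<Sum>m\<in>insert m0 F. C m * \<alpha> m ^ j)) < 1"
            using that unit[of m0 "\<Sum>m\<in>insert m0 F. C m * \<alpha> m ^ j" d] by (simp add: mult.commute)
          ultimately show ?thesis using that abs_diff_less by simp
        qed
        then have "{j \<in> ?S. j + d \<in> ?S} \<subseteq> {j. v (\<Sum>m\<in>F. D m * \<alpha> m ^ j) < 1}" by blast
        moreover have "density_zero {j. v (\<Sum>m\<in>F. D m * \<alpha> m ^ j) < 1}"
          using IH[of D] vD insert.prems(3) True by auto
        ultimately show "density_zero {j \<in> ?S. j + d \<in> ?S}" by (rule density_zero_subset[rotated])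
      qed
    qed
  qed
qed

text \<open>
  The general case follows from the normalised one on dividing by a largest coefficient.
\<close>
lemma power_sum_generic_abs:
  assumes M: "finite M"
    and unit: "\<And>m. m \<in> M \<Longrightarrow> v (\<alpha> m) = 1"
    and indep: "\<And>m m' d. m \<in> M \<Longrightarrow> m' \<in> M \<Longrightarrow> m \<noteq> m' \<Longrightarrow> 0 < (d::nat) \<Longrightarrow> v (\<alpha> m ^ d - \<alpha> m' ^ d) = 1"
  shows "density_zero {j. v (\<Sum>m\<in>M. C m * \<alpha> m ^ j) \<noteq> Max (insert 0 ((\<lambda>m. v (C m)) ` M))}"
proof -
  let ?B = "Max (insert 0 ((\<lambda>m. v (C m)) ` M))"
  have fin: "finite (insert 0 ((\<lambda>m. v (C m)) ` M))" using M by simp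
  have le: "v (C m) \<le> ?B" if "m \<in> M" for m using that fin by (intro Max_ge) auto
  show ?thesis
  proof (cases "?B = 0")
    case True
    then have "C m = 0" if "m \<in> M" for m using le[OF that] abs_nonneg[of "C m"] abs_eq_0[of "C m"] by linarith
    then have "(\<Sum>m\<in>M. C m * \<alpha> m ^ j) = 0" for j by simp
    then show ?thesis using True by simp
  next
    case False
    have "?B \<in> insert 0 ((\<lambda>m. v (C m)) ` M)" using fin by (intro Max_in) auto
    with False obtain m0 where m0: "m0 \<in> M" "v (C m0) = ?B" by auto
    then have nz: "C m0 \<noteq> 0" using False abs_zero by metis
    have pos: "?B > 0" using m0(2) nz abs_nonneg[of "C m0"] abs_eq_0[of "C m0"] by linarith
    have scale: "(\<Sum>m\<in>M. C m * \<alpha> m ^ j) = C m0 * (\<Sum>m\<in>M. C m / C m0 * \<alpha> m ^ j)" for j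
      using nz by (simp add: sum_distrib_left)
    have vdiv: "v (x / C m0) = v x / ?B" for x
      using m0(2) by (simp add: divide_inverse abs_mult abs_inverse)
    have "density_zero {j. v (\<Sum>m\<in>M. C m / C m0 * \<alpha> m ^ j) < 1}"
    proof (rule power_sum_normalised[OF M unit indep])
      show "v (C m / C m0) \<le> 1" if "m \<in> M" for m
        using le[OF that] pos by (simp add: vdiv)
      have "v (C m0 / C m0) = 1" using nz by simp
      then show "\<exists>m\<in>M. v (C m / C m0) = 1" using m0(1) by blast
    qed
    moreover have "v (\<Sum>m\<in>M. C m / C m0 * \<alpha> m ^ j) < 1" if "v (\<Sum>m\<in>M. C m * \<alpha> m ^ j) \<noteq> ?B" for j
    proof -
      have "v (\<Sum>m\<in>M. C m * \<alpha> m ^ j) \<le> ?B"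
        using pos le unit by (intro abs_sum_le) (auto simp: abs_mult abs_power)
      with that have "v (\<Sum>m\<in>M. C m * \<alpha> m ^ j) < ?B" by simp
      then have "?B * v (\<Sum>m\<in>M. C m / C m0 * \<alpha> m ^ j) < ?B"
        unfolding scale abs_mult m0(2) .
      then show ?thesis using pos by simp
    qed
    ultimately show ?thesis by (auto intro: density_zero_subset)
  qed
qed

end

section \<open>Powers of a generic vector and their limit seminorm\<close>

definition monom_value :: "('i::finite \<Rightarrow> 'c::comm_ring_1) \<Rightarrow> ('i \<Rightarrow>\<^sub>0 nat) \<Rightarrow> 'c" where
  "monom_value x m = (\<Prod>i\<in>UNIV. x i ^ Poly_Mapping.lookup m i)"

lemma monom_value_zero [simp]: "monom_value x 0 = 1"
  by (simp add: monom_value_def)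

lemma monom_value_add: "monom_value x (m + m') = monom_value x m * monom_value x m'"
  by (simp add: monom_value_def lookup_add power_add prod.distrib)

lemma monom_value_power: "monom_value (\<lambda>i. x i ^ j) m = monom_value x m ^ j"
  by (simp add: monom_value_def prod_power_distrib mult.commute flip: power_mult)

lemma monom_value_single [simp]: "monom_value x (Poly_Mapping.single i n) = x i ^ n"
proof -
  have "monom_value x (Poly_Mapping.single i n) = (\<Prod>k\<in>UNIV. if k = i then x i ^ n else 1)"
    unfolding monom_value_def by (intro prod.cong) (auto simp: lookup_single)
  then show ?thesis by simp
qed

lemma monom_value_scale:
  "monom_value (\<lambda>i. c * x i) m = c ^ (\<Sum>i\<in>UNIV. Poly_Mapping.lookup m i) * monom_value x m"
  by (simp add: monom_value_def power_mult_distrib prod.distrib power_sum)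

lemma mpoly_eval_alt: "mpoly_eval h f x = (\<Sum>m\<in>Poly_Mapping.keys f. h (Poly_Mapping.lookup f m) * monom_value x m)"
  by (simp add: mpoly_eval_def monom_value_def)

lemma mpoly_eval_superset:
  assumes "finite A" "Poly_Mapping.keys f \<subseteq> A" "h 0 = 0"
  shows "mpoly_eval h f x = (\<Sum>m\<in>A. h (Poly_Mapping.lookup f m) * monom_value x m)"
  unfolding mpoly_eval_alt
  using assms by (intro sum.mono_neutral_left) (auto simp: in_keys_iff)

lemma mpoly_eval_add: "mpoly_eval id (f + g) x = mpoly_eval id f x + mpoly_eval id g x"
proof -
  let ?A = "Poly_Mapping.keys f \<union> Poly_Mapping.keys g"
  have fin: "finite ?A" by simp
  show ?thesis
    using mpoly_eval_superset[OF fin, of "f + g" id x] mpoly_eval_superset[OF fin, of f id x]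
      mpoly_eval_superset[OF fin, of g id x] keys_add[of f g]
    by (simp add: lookup_add ring_distribs sum.distrib)
qed

lemma mpoly_eval_zero [simp]: "mpoly_eval id 0 x = 0"
  by (simp add: mpoly_eval_alt)

lemma mpoly_eval_single [simp]:
  "mpoly_eval id (Poly_Mapping.single m c) x = c * monom_value x m"
  by (cases "c = 0") (simp_all add: mpoly_eval_alt)

lemma mpoly_eval_sum: "mpoly_eval id (sum F A) x = (\<Sum>a\<in>A. mpoly_eval id (F a) x)"
  by (induction A rule: infinite_finite_induct)
     (simp_all only: sum.infinite sum.empty sum.insert mpoly_eval_zero mpoly_eval_add not_False_eq_True)

lemma sum_single_lookup: "(\<Sum>m\<in>Poly_Mapping.keys f. Poly_Mapping.single m (Poly_Mapping.lookup f m)) = f"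
proof (rule poly_mapping_eqI)
  fix k
  have "Poly_Mapping.lookup (\<Sum>m\<in>Poly_Mapping.keys f. Poly_Mapping.single m (Poly_Mapping.lookup f m)) k
      = (\<Sum>m\<in>Poly_Mapping.keys f. if m = k then Poly_Mapping.lookup f m else 0)"
    unfolding lookup_sum by (intro sum.cong) (auto simp: lookup_single)
  then show "Poly_Mapping.lookup (\<Sum>m\<in>Poly_Mapping.keys f. Poly_Mapping.single m (Poly_Mapping.lookup f m)) k = Poly_Mapping.lookup f k"
    by (simp add: in_keys_iff)
qed

lemma mpoly_eval_mult: "mpoly_eval id (f * g) x = mpoly_eval id f x * mpoly_eval id g x"
proof -
  have "f * g = (\<Sum>m\<in>Poly_Mapping.keys f. \<Sum>m'\<in>Poly_Mapping.keys g. Poly_Mapping.single m (Poly_Mapping.lookup f m) * Poly_Mapping.single m' (Poly_Mapping.lookup g m'))"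
    by (subst (1) sum_single_lookup[of f, symmetric], subst (1) sum_single_lookup[of g, symmetric])
       (rule sum_product)
  then have "mpoly_eval id (f * g) x
      = (\<Sum>m\<in>Poly_Mapping.keys f. \<Sum>m'\<in>Poly_Mapping.keys g. (Poly_Mapping.lookup f m * monom_value x m) * (Poly_Mapping.lookup g m' * monom_value x m'))"
    by (simp add: mult_single mpoly_eval_sum monom_value_add mult_ac)
  also have "\<dots> = mpoly_eval id f x * mpoly_eval id g x"
    by (simp add: mpoly_eval_alt sum_product)
  finally show ?thesis .
qed

lemma mpoly_eval_homogeneous_scale:
  assumes "homogeneous d f"
  shows "mpoly_eval id f (\<lambda>i. c * x i) = c ^ d * mpoly_eval id f x"
  using assms unfolding mpoly_eval_alt homogeneous_def
  by (auto simp: monom_value_scale sum_distrib_left mult_ac intro!: sum.cong)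

context valued_field
begin

lemma eval_seminorm_in_berk_affine: "eval_seminorm v x \<in> berk_affine v"
  by (simp add: berk_affine_def eval_seminorm_def mpoly_eval_add mpoly_eval_mult abs_mult abs_add_le)

definition gauss_norm :: "('i::finite, 'k) mpoly \<Rightarrow> real" where
  "gauss_norm f = Max (insert 0 ((\<lambda>m. v (Poly_Mapping.lookup f m)) ` Poly_Mapping.keys f))"

lemma gauss_norm_ge: "v (Poly_Mapping.lookup f m) \<le> gauss_norm f"
  unfolding gauss_norm_def by (cases "m \<in> Poly_Mapping.keys f") (auto intro!: Max_ge simp: in_keys_iff)

lemma gauss_norm_nonneg: "0 \<le> gauss_norm f"
  unfolding gauss_norm_def by (intro Max_ge) auto

lemma eval_seminorm_le_gauss_norm:
  assumes "\<And>i. v (x i) \<le> 1"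
  shows "eval_seminorm v x f \<le> gauss_norm f"
  unfolding eval_seminorm_def mpoly_eval_alt
proof (rule abs_sum_le)
  fix m
  have "v (monom_value x m) \<le> 1"
    unfolding monom_value_def abs_prod abs_power using assms by (intro prod_le_1) (simp add: power_le_one)
  then have "v (Poly_Mapping.lookup f m) * v (monom_value x m) \<le> gauss_norm f * 1"
    using gauss_norm_ge gauss_norm_nonneg by (intro mult_mono) auto
  then show "v (id (Poly_Mapping.lookup f m) * monom_value x m) \<le> gauss_norm f" by (simp add: abs_mult)
qed (rule gauss_norm_nonneg)

text \<open>
  The condition is phrased for monomials with distinct values, not for distinct monomials: in the
  application one coordinate of \<open>x\<close> is \<open>1\<close>, so that distinct monomials may well take the same value.
\<close>
definition generic :: "('i::finite \<Rightarrow> 'k) \<Rightarrow> bool" where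
  "generic x \<longleftrightarrow> (\<forall>i. v (x i) = 1) \<and>
     (\<forall>m m' d. d > 0 \<longrightarrow> monom_value x m \<noteq> monom_value x m' \<longrightarrow>
       v (monom_value x m ^ d - monom_value x m' ^ d) = 1)"

lemma generic_abs_monom:
  assumes "generic x" shows "v (monom_value x m) = 1"
  using assms by (simp add: generic_def monom_value_def abs_prod abs_power)

lemma eval_power: "eval_seminorm v (\<lambda>i. x i ^ j) f = v (\<Sum>m\<in>Poly_Mapping.keys f. Poly_Mapping.lookup f m * monom_value x m ^ j)"
  by (simp add: eval_seminorm_def mpoly_eval_alt monom_value_power)

text \<open>
  Collecting the monomials that take the same value at \<open>x\<close> turns \<open>f (x\<^sup>j)\<close> into a power sum with
  well separated bases.
\<close>
lemma generic_eval_eventually_const: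
  assumes x: "generic x"
  shows "\<exists>c. density_zero {j. eval_seminorm v (\<lambda>i. x i ^ j) f \<noteq> c}"
proof -
  let ?A = "monom_value x ` Poly_Mapping.keys f"
  define C where "C \<alpha> = (\<Sum>m\<in>{m\<in>Poly_Mapping.keys f. monom_value x m = \<alpha>}. Poly_Mapping.lookup f m)" for \<alpha>
  have "(\<Sum>m\<in>Poly_Mapping.keys f. Poly_Mapping.lookup f m * monom_value x m ^ j) = (\<Sum>\<alpha>\<in>?A. C \<alpha> * \<alpha> ^ j)" for j
  proof -
    have "(\<Sum>m\<in>Poly_Mapping.keys f. Poly_Mapping.lookup f m * monom_value x m ^ j)
        = (\<Sum>\<alpha>\<in>?A. \<Sum>m\<in>{m\<in>Poly_Mapping.keys f. monom_value x m = \<alpha>}. Poly_Mapping.lookup f m * monom_value x m ^ j)"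
      by (rule sum.image_gen) simp
    also have "\<dots> = (\<Sum>\<alpha>\<in>?A. C \<alpha> * \<alpha> ^ j)"
      unfolding C_def sum_distrib_right by (intro sum.cong) auto
    finally show ?thesis .
  qed
  moreover have "density_zero {j. v (\<Sum>\<alpha>\<in>?A. C \<alpha> * \<alpha> ^ j) \<noteq> Max (insert 0 ((\<lambda>\<alpha>. v (C \<alpha>)) ` ?A))}"
  proof (rule power_sum_generic_abs)
    show "v \<alpha> = 1" if "\<alpha> \<in> ?A" for \<alpha> using that generic_abs_monom[OF x] by auto
    show "v (\<alpha> ^ d - \<beta> ^ d) = 1" if "\<alpha> \<in> ?A" "\<beta> \<in> ?A" "\<alpha> \<noteq> \<beta>" "0 < d" for \<alpha> \<beta> d
      using that x by (auto simp: generic_def)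
  qed simp
  ultimately show ?thesis unfolding eval_power by (intro exI) simp
qed

text \<open>
  When no two monomials of \<open>f\<close> share a value, nothing is collected and the constant is the Gauss norm.
\<close>
lemma generic_eval_gauss_norm:
  assumes x: "generic x" and inj: "inj_on (monom_value x) (Poly_Mapping.keys f)"
  shows "density_zero {j. eval_seminorm v (\<lambda>i. x i ^ j) f \<noteq> gauss_norm f}"
  unfolding eval_power gauss_norm_def
proof (rule power_sum_generic_abs)
  show "v (monom_value x m ^ d - monom_value x m' ^ d) = 1"
    if "m \<in> Poly_Mapping.keys f" "m' \<in> Poly_Mapping.keys f" "m \<noteq> m'" "0 < d" for m m' d
  proof -
    have "monom_value x m \<noteq> monom_value x m'" using that inj by (auto dest: inj_onD)
    then show ?thesis using that(4) x unfolding generic_def by blast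
  qed
qed (auto simp: generic_abs_monom[OF x])

text \<open>
  The value is unique because two sets of density zero do not cover the natural numbers. Geometrically,
  when \<open>x\<close> is \<open>(1, y)\<close> with the reduction of \<open>y\<close> multiplicatively independent, this is the Gauss point of
  the affine chart \<open>X\<^sub>0 = 1\<close>.
\<close>
definition generic_limit :: "('i::finite \<Rightarrow> 'k) \<Rightarrow> ('i, 'k) mpoly \<Rightarrow> real" where
  "generic_limit x f = (THE c. density_zero {j. eval_seminorm v (\<lambda>i. x i ^ j) f \<noteq> c})"

lemma generic_limit_eqI:
  assumes "density_zero {j. eval_seminorm v (\<lambda>i. x i ^ j) f \<noteq> c}"
  shows "generic_limit x f = c"
  unfolding generic_limit_def
proof (rule the_equality, rule assms)
  fix c' assume "density_zero {j. eval_seminorm v (\<lambda>i. x i ^ j) f \<noteq> c'}"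
  from density_zero_avoid[OF density_zero_Un[OF assms this]] show "c' = c" by auto
qed

lemma eval_eq_generic_limit:
  assumes "generic x"
  shows "density_zero {j. eval_seminorm v (\<lambda>i. x i ^ j) f \<noteq> generic_limit x f}"
proof -
  obtain c where c: "density_zero {j. eval_seminorm v (\<lambda>i. x i ^ j) f \<noteq> c}"
    using generic_eval_eventually_const[OF assms] by blast
  then show ?thesis using generic_limit_eqI by metis
qed

text \<open>
  Every identity or inequality between finitely many values that holds at all the points \<open>x\<^sup>j\<close> passes to
  the limit through this lemma.
\<close>
lemma generic_limit_attained:
  assumes "generic x" "finite F"
  shows "\<exists>j. \<forall>f\<in>F. eval_seminorm v (\<lambda>i. x i ^ j) f = generic_limit x f"
proof -
  have "density_zero (\<Union>f\<in>F. {j. eval_seminorm v (\<lambda>i. x i ^ j) f \<noteq> generic_limit x f})"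
    using assms(2) by (induction F) (auto intro: density_zero_Un eval_eq_generic_limit[OF assms(1)])
  from density_zero_avoid[OF this] show ?thesis by auto
qed

lemma generic_limit_in_berk_affine:
  assumes "generic x" shows "generic_limit x \<in> berk_affine v"
proof -
  let ?e = "\<lambda>j. eval_seminorm v (\<lambda>i. x i ^ j)"
  have e: "?e j \<in> berk_affine v" for j by (rule eval_seminorm_in_berk_affine)
  have "0 \<le> generic_limit x f" for f
    using generic_limit_attained[OF assms, of "{f}"] e
    by (metis (no_types, lifting) berk_affine_def finite.emptyI finite.insertI insertI1 mem_Collect_eq)
  moreover have "generic_limit x (mconst c) = v c" for c
    using generic_limit_attained[OF assms, of "{mconst c}"] e by (auto simp: berk_affine_def)
  moreover have "generic_limit x (f + g) \<le> max (generic_limit x f) (generic_limit x g)" for f g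
  proof -
    obtain j where "\<forall>h\<in>{f, g, f + g}. ?e j h = generic_limit x h"
      using generic_limit_attained[OF assms, of "{f, g, f + g}"] by auto
    moreover have "?e j (f + g) \<le> max (?e j f) (?e j g)" using e[of j] unfolding berk_affine_def by blast
    ultimately show ?thesis by simp
  qed
  moreover have "generic_limit x (f * g) = generic_limit x f * generic_limit x g" for f g
  proof -
    obtain j where "\<forall>h\<in>{f, g, f * g}. ?e j h = generic_limit x h"
      using generic_limit_attained[OF assms, of "{f, g, f * g}"] by auto
    moreover have "?e j (f * g) = ?e j f * ?e j g" using e[of j] unfolding berk_affine_def by blast
    ultimately show ?thesis by (metis insertI1 insertI2)
  qed
  ultimately show ?thesis by (simp add: berk_affine_def)
qed

end

section \<open>The Gauss norm\<close>

lemma obtain_distinct_primes: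
  obtains p :: "'i::finite \<Rightarrow> nat" where "inj p" "\<And>i. prime (p i)"
proof -
  obtain P where P: "finite P" "card P = CARD('i)" "P \<subseteq> {p::nat. prime p}"
    using infinite_arbitrarily_large[OF primes_infinite] by metis
  then obtain p :: "'i \<Rightarrow> nat" where "bij_betw p UNIV P"
    using finite_same_card_bij[of "UNIV :: 'i set" P] by auto
  then show ?thesis using P that[of p] by (auto simp: bij_betw_def)
qed

lemma prod_prime_powers_inj:
  fixes p :: "'i::finite \<Rightarrow> nat"
  assumes "inj p" "\<And>i. prime (p i)" "(\<Prod>i\<in>UNIV. p i ^ e i) = (\<Prod>i\<in>UNIV. p i ^ e' i)"
  shows "e = e'"
proof
  fix i
  have "multiplicity (p i) (\<Prod>k\<in>UNIV. p k ^ e k) = e i" for e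
  proof -
    have "(\<Prod>k\<in>UNIV. p k ^ e k) = (\<Prod>q\<in>range p. q ^ e (inv_into UNIV p q))"
      using assms(1) by (simp add: prod.reindex)
    moreover have "multiplicity (p i) (\<Prod>q\<in>range p. q ^ e (inv_into UNIV p q)) = e (inv_into UNIV p (p i))"
      using assms(2) by (subst multiplicity_prod_prime_powers) auto
    ultimately show ?thesis using assms(1) by simp
  qed
  with assms(3) show "e i = e' i" by metis
qed

context valued_field
begin

text \<open>
  Take distinct primes as coordinates. Monomials then take distinct positive integer values by unique
  factorisation, and in residue characteristic zero the difference of two distinct integers is a unit.
\<close>
lemma exists_generic_inj:
  assumes char0: "\<And>n::nat. n > 0 \<Longrightarrow> v (of_nat n) = 1"
  shows "\<exists>x :: 'i::finite \<Rightarrow> 'k. generic x \<and> inj (monom_value x)"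
proof -
  obtain p :: "'i \<Rightarrow> nat" where p: "inj p" "\<And>i. prime (p i)" using obtain_distinct_primes by blast
  let ?x = "\<lambda>i. of_nat (p i) :: 'k"
  let ?P = "\<lambda>e. \<Prod>i\<in>UNIV. p i ^ e i"
  have val: "monom_value ?x m = of_nat (?P (Poly_Mapping.lookup m))" for m
    by (simp add: monom_value_def)
  have diff: "v (of_nat a - of_nat b) = 1" if "a \<noteq> b" for a b :: nat
    using that
  proof (induction a b rule: linorder_wlog)
    case (le a b)
    then have "v (of_nat (b - a)) = 1" by (intro char0) simp
    then show ?case using le abs_diff_commute[of "of_nat a" "of_nat b"] by (simp add: of_nat_diff)
  next
    case (sym a b)
    then show ?case using abs_diff_commute[of "of_nat a" "of_nat b"] by simp
  qed
  have inj: "m = m'" if "?P (Poly_Mapping.lookup m) = ?P (Poly_Mapping.lookup m')" for m m'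
    using prod_prime_powers_inj[OF p that] by (simp add: poly_mapping_eqI)
  have "generic ?x"
    unfolding generic_def
  proof (intro conjI allI impI)
    fix i show "v (?x i) = 1" using char0 p(2) prime_gt_0_nat by blast
  next
    fix m m' :: "'i \<Rightarrow>\<^sub>0 nat" and d :: nat
    assume d: "0 < d" and "monom_value ?x m \<noteq> monom_value ?x m'"
    then have "?P (Poly_Mapping.lookup m) ^ d \<noteq> ?P (Poly_Mapping.lookup m') ^ d" unfolding val by (metis power_eq_iff_eq_base zero_le)
    then show "v (monom_value ?x m ^ d - monom_value ?x m' ^ d) = 1"
      unfolding val of_nat_power[symmetric] by (rule diff)
  qed
  moreover have "inj (monom_value ?x)"
  proof (rule injI)
    fix m m' :: "'i \<Rightarrow>\<^sub>0 nat" assume "monom_value ?x m = monom_value ?x m'"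
    then have "v (of_nat (?P (Poly_Mapping.lookup m)) - of_nat (?P (Poly_Mapping.lookup m'))) = 0" unfolding val by simp
    then show "m = m'" using diff inj by (metis zero_neq_one)
  qed
  ultimately show ?thesis by blast
qed

text \<open>
  This contains Gauss's lemma: the Gauss norm is the limit seminorm of a generic vector without
  coincidences among its monomials, and limit seminorms are multiplicative.
\<close>
lemma gauss_norm_in_berk_affine:
  assumes char0: "\<And>n::nat. n > 0 \<Longrightarrow> v (of_nat n) = 1"
  shows "(gauss_norm :: ('i::finite, 'k) mpoly \<Rightarrow> real) \<in> berk_affine v"
proof -
  obtain x :: "'i \<Rightarrow> 'k" where x: "generic x" "inj (monom_value x)" using exists_generic_inj[OF char0] by blast
  have "generic_limit x f = gauss_norm f" for f
    by (intro generic_limit_eqI generic_eval_gauss_norm x(1) inj_on_subset[OF x(2)]) simp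
  then have "generic_limit x = gauss_norm" by blast
  then show ?thesis using generic_limit_in_berk_affine[OF x(1)] by simp
qed

text \<open>
  The ultrametric inequality bounds the supremum by the Gauss norm. The bound is attained already at a
  \<open>K\<close>-rational point, namely at some power of a generic vector.
\<close>
lemma gauss_seminorm_eq_gauss_norm:
  fixes w :: "'c::field \<Rightarrow> real" and \<iota> :: "'k alg_closure \<Rightarrow> 'c" and f :: "('i::finite, 'k) mpoly"
  assumes char0: "\<And>n::nat. n > 0 \<Longrightarrow> v (of_nat n) = 1"
    and C: "completed_alg_closure v w \<iota>"
  shows "gauss_seminorm w \<iota> f = gauss_norm f"
proof -
  interpret W: valued_field w using C by unfold_locales (simp add: completed_alg_closure_def)
  define h where "h c = \<iota> (to_ac c)" for c
  have hom: "\<iota> \<in> ring_hom ring_of_type_algebra ring_of_type_algebra" and wh: "w (h c) = v c" for c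
    using C by (auto simp: completed_alg_closure_def h_def)
  have h_add: "h (a + b) = h a + h b" and h_mult: "h (a * b) = h a * h b" and h_one: "h 1 = 1" for a b
    using ring_hom_add[OF hom, of "to_ac a" "to_ac b"] ring_hom_mult[OF hom, of "to_ac a" "to_ac b"]
      ring_hom_one[OF hom]
    by (simp_all add: ring_of_type_algebra_def h_def)
  have h_zero: "h 0 = 0" using wh[of 0] by (metis W.abs_eq_0 abs_zero)
  have h_sum: "h (sum g A) = (\<Sum>a\<in>A. h (g a))" for g :: "'a \<Rightarrow> 'k" and A
    by (induction A rule: infinite_finite_induct) (simp_all add: h_zero h_add)
  have h_prod: "h (prod g A) = (\<Prod>a\<in>A. h (g a))" for g :: "'a \<Rightarrow> 'k" and A
    by (induction A rule: infinite_finite_induct) (simp_all add: h_one h_mult)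
  have h_power: "h (a ^ n) = h a ^ n" for a n
    by (induction n) (simp_all add: h_one h_mult)
  have eval_h: "mpoly_eval h f (\<lambda>i. h (x i)) = h (mpoly_eval id f x)" for x
    by (simp add: mpoly_eval_def h_sum h_mult h_prod h_power)
  have "gauss_norm f \<in> (\<lambda>b. w (mpoly_eval h f b)) ` {b. \<forall>i. w (b i) \<le> 1}"
  proof -
    obtain x :: "'i \<Rightarrow> 'k" where x: "generic x" "inj (monom_value x)" using exists_generic_inj[OF char0] by blast
    have "density_zero {j. eval_seminorm v (\<lambda>i. x i ^ j) f \<noteq> gauss_norm f}"
      by (intro generic_eval_gauss_norm x(1) inj_on_subset[OF x(2)]) simp
    then obtain j where "eval_seminorm v (\<lambda>i. x i ^ j) f = gauss_norm f" using density_zero_avoid by blast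
    then have "gauss_norm f = w (mpoly_eval h f (\<lambda>i. h (x i ^ j)))"
      by (simp add: eval_seminorm_def eval_h wh)
    moreover have "w (h (x i ^ j)) \<le> 1" for i
      using x(1) by (simp add: wh generic_def abs_power)
    ultimately show ?thesis by (intro image_eqI[of _ _ "\<lambda>i. h (x i ^ j)"]) auto
  qed
  moreover have "w (mpoly_eval h f b) \<le> gauss_norm f" if "\<forall>i. w (b i) \<le> 1" for b
    unfolding mpoly_eval_alt
  proof (rule W.abs_sum_le)
    fix m
    have "w (monom_value b m) \<le> 1"
      unfolding monom_value_def W.abs_prod W.abs_power using that by (intro prod_le_1) (simp add: power_le_one)
    then have "v (Poly_Mapping.lookup f m) * w (monom_value b m) \<le> gauss_norm f * 1"
      using gauss_norm_ge gauss_norm_nonneg by (intro mult_mono) auto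
    then show "w (h (Poly_Mapping.lookup f m) * monom_value b m) \<le> gauss_norm f" by (simp add: W.abs_mult wh)
  qed (rule gauss_norm_nonneg)
  ultimately show ?thesis
    unfolding gauss_seminorm_def h_def[symmetric] by (intro cSup_eq_maximum) auto
qed

end

section \<open>Equidistribution of the powers of a generic vector\<close>

abbreviation mvar :: "'i \<Rightarrow> ('i, 'k::field) mpoly" where
  "mvar i \<equiv> Poly_Mapping.single (Poly_Mapping.single i (Suc 0)) 1"

text \<open>
  By Tychonoff's theorem: the set is closed in a product of compact intervals, and the topology of affine
  space is no finer than the one induced from the product. The condition \<open>\<zeta> g = 1\<close> serves, for a
  coordinate function \<open>g\<close>, to keep the set away from the origin.
\<close>
lemma compactin_berk_affine_box:
  fixes B :: "('i::finite, 'k::field) mpoly \<Rightarrow> real"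
  shows "compactin (berk_affine_topology v) {\<zeta> \<in> berk_affine v. (\<forall>f. \<zeta> f \<le> B f) \<and> \<zeta> g = 1}"
    (is "compactin _ ?S")
proof -
  have coord: "continuous_on UNIV (\<lambda>\<zeta> :: ('i, 'k) mpoly \<Rightarrow> real. \<zeta> f)" for f
    by (rule continuous_on_product_coordinates)
  have "closed ?S"
    unfolding berk_affine_def mem_Collect_eq
    by (intro closed_Collect_conj closed_Collect_all closed_Collect_le closed_Collect_eq
        continuous_on_const continuous_on_max continuous_on_mult coord)
  moreover have "compact (Pi\<^sub>E UNIV (\<lambda>f. {0..B f}))"
    using compactin_PiE[of "\<lambda>_. euclideanreal" UNIV "\<lambda>f. {0..B f}"]
    by (simp add: euclidean_product_topology)
  ultimately have "compact (Pi\<^sub>E UNIV (\<lambda>f. {0..B f}) \<inter> ?S)"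
    by (rule compact_Int_closed[rotated])
  moreover have "Pi\<^sub>E UNIV (\<lambda>f. {0..B f}) \<inter> ?S = ?S"
    by (auto simp: berk_affine_def)
  ultimately have "compactin (top_of_set (berk_affine v)) ?S"
    by (simp add: compactin_subtopology)
  moreover have "continuous_map (top_of_set (berk_affine v)) (berk_affine_topology v)
      (\<lambda>\<zeta> :: ('i, 'k) mpoly \<Rightarrow> real. \<zeta>)"
    unfolding berk_affine_topology_def
  proof (rule continuous_on_generated_topo)
    fix W assume "W \<in> {{\<zeta> \<in> berk_affine v. \<zeta> f \<in> U} | (f :: ('i, 'k) mpoly) U. open U}"
    then obtain f :: "('i, 'k) mpoly" and U where W: "W = {\<zeta> \<in> berk_affine v. \<zeta> f \<in> U}" and "open U" by blast
    then have "open ((\<lambda>\<zeta> :: ('i, 'k) mpoly \<Rightarrow> real. \<zeta> f) -` U)"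
      using coord open_vimage by blast
    moreover have "(\<lambda>\<zeta>. \<zeta>) -` W \<inter> topspace (top_of_set (berk_affine v)) = berk_affine v \<inter> (\<lambda>\<zeta>. \<zeta> f) -` U"
      unfolding W by auto
    ultimately show "openin (top_of_set (berk_affine v)) ((\<lambda>\<zeta>. \<zeta>) -` W \<inter> topspace (top_of_set (berk_affine v)))"
      by (simp add: openin_open_Int)
  next
    show "(\<lambda>\<zeta>. \<zeta>) ` topspace (top_of_set (berk_affine v))
        \<subseteq> \<Union> {{\<zeta> \<in> berk_affine v. \<zeta> f \<in> U} | (f :: ('i, 'k) mpoly) U. open U}"
      using open_UNIV by auto
  qed
  ultimately show ?thesis
    using image_compactin by fastforce
qed

lemma topspace_berk_punctured [simp]:
  "topspace (subtopology (berk_affine_topology v) (berk_punctured v)) = berk_punctured v"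
  by (auto simp: berk_punctured_def)

context valued_field
begin

lemma eval_seminorm_mvar [simp]: "eval_seminorm v x (mvar i) = v (x i)"
  by (simp add: eval_seminorm_def)

lemma berk_punctured_if_mvar:
  assumes "\<zeta> \<in> berk_affine v" "\<zeta> (mvar i) \<noteq> 0"
  shows "\<zeta> \<in> berk_punctured v"
  using assms unfolding berk_punctured_def by auto

lemma gauss_norm_single [simp]: "gauss_norm (Poly_Mapping.single m c) = v c"
  by (cases "c = 0") (simp_all add: gauss_norm_def)

lemma generic_limit_le_gauss_norm:
  assumes "generic x"
  shows "generic_limit x f \<le> gauss_norm f"
proof -
  obtain j where "eval_seminorm v (\<lambda>i. x i ^ j) f = generic_limit x f"
    using generic_limit_attained[OF assms, of "{f}"] by auto
  moreover have "eval_seminorm v (\<lambda>i. x i ^ j) f \<le> gauss_norm f"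
    using assms by (intro eval_seminorm_le_gauss_norm) (simp add: generic_def abs_power)
  ultimately show ?thesis by simp
qed

lemma generic_limit_mvar:
  assumes "generic x"
  shows "generic_limit x (mvar i) = 1"
proof (rule generic_limit_eqI)
  have "{j. eval_seminorm v (\<lambda>i. x i ^ j) (mvar i) \<noteq> 1} = {}"
    using assms unfolding eval_seminorm_mvar by (simp add: generic_def abs_power)
  then show "density_zero {j. eval_seminorm v (\<lambda>i. x i ^ j) (mvar i) \<noteq> 1}" by (metis density_zero_empty)
qed

text \<open>
  The property is inherited by finite intersections and by unions, so the subbasic open sets suffice.
\<close>
lemma generic_limit_neighbourhood:
  assumes x: "generic x" and U: "openin (berk_affine_topology v) U" and "generic_limit x \<in> U"
  shows "density_zero {j. eval_seminorm v (\<lambda>i. x i ^ j) \<notin> U}"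
proof -
  have "generate_topology_on {{\<zeta> \<in> berk_affine v. \<zeta> f \<in> U} | f U. open U} U"
    using U unfolding berk_affine_topology_def openin_topology_generated_by_iff .
  then show ?thesis using assms(3)
  proof (induction rule: generate_topology_on.induct)
    case (Int a b)
    then have "density_zero ({j. eval_seminorm v (\<lambda>i. x i ^ j) \<notin> a} \<union> {j. eval_seminorm v (\<lambda>i. x i ^ j) \<notin> b})"
      by (intro density_zero_Un) auto
    then show ?case by (rule density_zero_subset) auto
  next
    case (UN K)
    then obtain k where "k \<in> K" "generic_limit x \<in> k" by blast
    then have "density_zero {j. eval_seminorm v (\<lambda>i. x i ^ j) \<notin> k}" using UN by blast
    then show ?case by (rule density_zero_subset) (use \<open>k \<in> K\<close> in blast)
  next
    case (Basis s)
    then obtain f V where s: "s = {\<zeta> \<in> berk_affine v. \<zeta> f \<in> V}" by blast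
    have "{j. eval_seminorm v (\<lambda>i. x i ^ j) \<notin> s} \<subseteq> {j. eval_seminorm v (\<lambda>i. x i ^ j) f \<noteq> generic_limit x f}"
      using Basis(2) eval_seminorm_in_berk_affine unfolding s by auto
    then show ?case using eval_eq_generic_limit[OF x] by (rule density_zero_subset[rotated])
  qed simp
qed

text \<open>
  The pullback of \<open>\<phi>\<close> to affine space is bounded on a compact set containing the \<open>x\<^sup>j\<close> and their limit,
  and near its limit value outside a set of density zero.
\<close>
lemma generic_powers_equidistribute:
  fixes x :: "'i::finite \<Rightarrow> 'k"
  assumes x: "generic x" and h: "continuous_map (berk_proj_topology v) euclideanreal \<phi>"
  shows "(\<lambda>l. (\<Sum>j\<in>{1..Suc l}. \<phi> (berk_pi v (eval_seminorm v (\<lambda>i. x i ^ j)))) / real (Suc l))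
    \<longlonglongrightarrow> \<phi> (berk_pi v (generic_limit x))"
proof -
  let ?X = "subtopology (berk_affine_topology v) (berk_punctured v) :: (('i, 'k) mpoly \<Rightarrow> real) topology"
  let ?e = "\<lambda>j. eval_seminorm v (\<lambda>i. x i ^ j)"
  define h where "h = \<phi> \<circ> berk_pi v"
  have cont: "continuous_map ?X euclideanreal h"
    unfolding h_def using quotient_imp_continuous_map[OF quotient_map_berk_pi] assms(2)
    by (rule continuous_map_compose)
  \<comment> \<open>Any index will do, as all coordinates of \<open>x\<close> have absolute value one.\<close>
  obtain i0 :: 'i where True by simp
  define S where "S = {\<zeta> \<in> berk_affine v. (\<forall>f. \<zeta> f \<le> gauss_norm f) \<and> \<zeta> (mvar i0) = 1}"
  have S_punctured: "S \<subseteq> berk_punctured v"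
    unfolding S_def by (auto intro!: berk_punctured_if_mvar[of _ i0])
  have e_S: "?e j \<in> S" for j
  proof -
    have "v (x i ^ j) = 1" for i using x by (simp add: generic_def abs_power)
    then show ?thesis
      using eval_seminorm_in_berk_affine eval_seminorm_le_gauss_norm[of "\<lambda>i. x i ^ j"] by (simp add: S_def)
  qed
  have lim_S: "generic_limit x \<in> S"
    unfolding S_def using x generic_limit_in_berk_affine generic_limit_le_gauss_norm generic_limit_mvar by blast
  have "compactin ?X S"
    using S_punctured compactin_berk_affine_box unfolding compactin_subtopology S_def by blast
  then have "compact (h ` S)"
    using image_compactin[OF _ cont] by simp
  then obtain B where "\<forall>y \<in> h ` S. norm y \<le> B"
    using compact_imp_bounded bounded_iff by metis
  then have B: "\<bar>h \<zeta>\<bar> \<le> B" if "\<zeta> \<in> S" for \<zeta>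
    using imageI[OF that, of h] unfolding real_norm_def by (rule bspec)
  have "(\<lambda>l. (\<Sum>j\<in>{1..Suc l}. h (?e j)) / real (Suc l)) \<longlonglongrightarrow> h (generic_limit x)"
  proof (rule averages_tendsto)
    show "\<bar>h (?e j)\<bar> \<le> B" for j using B[OF e_S] .
    fix r :: real assume r: "r > 0"
    let ?W = "{\<zeta> \<in> topspace ?X. h \<zeta> \<in> ball (h (generic_limit x)) r}"
    have "openin ?X ?W"
      using cont by (rule openin_continuous_map_preimage) simp
    then obtain U where U: "openin (berk_affine_topology v) U" "?W = U \<inter> berk_punctured v"
      unfolding openin_subtopology by blast
    have "generic_limit x \<in> ?W" using r lim_S S_punctured unfolding topspace_berk_punctured by auto
    then have "generic_limit x \<in> U" using U(2) by blast
    then have "density_zero {j. ?e j \<notin> U}" using generic_limit_neighbourhood[OF x U(1)] by blast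
    moreover have "\<bar>h (?e j) - h (generic_limit x)\<bar> < r" if "?e j \<in> U" for j
    proof -
      have "?e j \<in> ?W" using that e_S S_punctured U(2) by blast
      then show ?thesis by (simp add: dist_real_def abs_minus_commute)
    qed
    ultimately show "density_zero {j. \<not> \<bar>h (?e j) - h (generic_limit x)\<bar> < r}"
      by (auto elim: density_zero_subset)
  qed
  then show ?thesis by (simp add: h_def)
qed

lemma berk_pi_eqI:
  assumes "\<zeta> \<in> berk_punctured v" "\<xi> \<in> berk_punctured v" "r > 0"
    and "\<And>d f. homogeneous d f \<Longrightarrow> \<zeta> f = r ^ d * \<xi> f"
  shows "berk_pi v \<zeta> = berk_pi v \<xi>"
  unfolding berk_pi_def
  by (rule equiv_class_eq[OF equiv_berk_equiv]) (use assms in \<open>auto simp: berk_equiv_def\<close>)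

lemma eval_seminorm_in_berk_punctured:
  assumes "x i \<noteq> 0"
  shows "eval_seminorm v x \<in> berk_punctured v"
  using assms by (intro berk_punctured_if_mvar[of _ i] eval_seminorm_in_berk_affine) simp

lemma berk_incl_proj_point:
  assumes "x i \<noteq> 0"
  shows "berk_incl v (proj_point ring_of_type_algebra x) = berk_pi v (eval_seminorm v x)"
proof -
  have "berk_pi v (eval_seminorm v (\<lambda>i. c * x i)) = berk_pi v (eval_seminorm v x)" if "c \<noteq> 0" for c
  proof (rule berk_pi_eqI)
    show "v c > 0" using that abs_nonneg[of c] abs_eq_0[of c] by linarith
    show "eval_seminorm v (\<lambda>i. c * x i) f = v c ^ d * eval_seminorm v x f" if "homogeneous d f" for d f
      using mpoly_eval_homogeneous_scale[OF that] by (simp add: eval_seminorm_def abs_mult abs_power)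
    show "eval_seminorm v (\<lambda>i. c * x i) \<in> berk_punctured v" "eval_seminorm v x \<in> berk_punctured v"
      using assms that by (auto intro!: eval_seminorm_in_berk_punctured[of _ i])
  qed
  then have "(\<Union>y\<in>{\<lambda>i. c * x i | c. c \<noteq> 0}. berk_pi v (eval_seminorm v y)) = berk_pi v (eval_seminorm v x)"
    by (auto intro!: exI[of _ "\<lambda>i. 1 * x i"] exI[of _ 1] simp del: mult_1)
  then show ?thesis unfolding berk_incl_def proj_point_type_eq .
qed

text \<open>
  Points of projective space only see homogeneous polynomials. For these it is enough that distinct
  monomials of equal degree take distinct values, a condition that a coordinate equal to \<open>1\<close> does not violate.
\<close>
lemma berk_pi_generic_limit:
  assumes x: "generic x"
    and inj: "\<And>m m'. monom_value x m = monom_value x m' \<Longrightarrow>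
      (\<Sum>i\<in>UNIV. Poly_Mapping.lookup m i) = (\<Sum>i\<in>UNIV. Poly_Mapping.lookup m' i) \<Longrightarrow> m = m'"
    and gauss: "(gauss_norm :: ('i::finite, 'k) mpoly \<Rightarrow> real) \<in> berk_affine v"
  shows "berk_pi v (generic_limit x) = berk_pi v (gauss_norm :: ('i, 'k) mpoly \<Rightarrow> real)"
proof (rule berk_pi_eqI[where r = 1])
  show "generic_limit x \<in> berk_punctured v"
    using berk_punctured_if_mvar[OF generic_limit_in_berk_affine[OF x]] generic_limit_mvar[OF x]
    by (metis zero_neq_one)
  show "(gauss_norm :: ('i, 'k) mpoly \<Rightarrow> real) \<in> berk_punctured v"
    using berk_punctured_if_mvar[OF gauss] gauss_norm_single abs_one by (metis zero_neq_one)
  fix d and f :: "('i, 'k) mpoly"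
  assume "homogeneous d f"
  then have "inj_on (monom_value x) (Poly_Mapping.keys f)"
    unfolding homogeneous_def by (intro inj_onI inj) simp_all
  from generic_limit_eqI[OF generic_eval_gauss_norm[OF x this]]
  show "generic_limit x f = 1 ^ d * gauss_norm f" by simp
qed simp

end

section \<open>Reduction and multiplicative dependence\<close>

context valued_field
begin

abbreviation R where "R \<equiv> valuation_ring v"
abbreviation F where "F \<equiv> residue_field v"

lemma valuation_ring_simps:
  "carrier R = {x. v x \<le> 1}" "x \<otimes>\<^bsub>R\<^esub> y = x * y" "x \<oplus>\<^bsub>R\<^esub> y = x + y" "\<one>\<^bsub>R\<^esub> = 1" "\<zero>\<^bsub>R\<^esub> = 0"
  by (simp_all add: valuation_ring_def ring_of_type_algebra_def)

lemma cring_valuation_ring: "cring R"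
proof (rule cringI)
  show "abelian_group R"
  proof (rule abelian_groupI)
    fix x y assume "x \<in> carrier R" "y \<in> carrier R"
    then show "x \<oplus>\<^bsub>R\<^esub> y \<in> carrier R" using abs_add_le[of x y] by (simp add: valuation_ring_simps)
  next
    fix x assume "x \<in> carrier R"
    then show "\<exists>y\<in>carrier R. y \<oplus>\<^bsub>R\<^esub> x = \<zero>\<^bsub>R\<^esub>"
      by (intro bexI[of _ "- x"]) (simp_all add: valuation_ring_simps)
  qed (auto simp: valuation_ring_simps)
  show "Group.comm_monoid R"
    by (rule comm_monoidI) (auto simp: valuation_ring_simps abs_mult mult_le_one)
qed (auto simp: valuation_ring_simps ring_distribs)

lemma a_inv_valuation_ring:
  assumes "v x \<le> 1" shows "\<ominus>\<^bsub>R\<^esub> x = - x"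
proof -
  interpret cring R by (rule cring_valuation_ring)
  show ?thesis using assms by (intro minus_equality) (simp_all add: valuation_ring_simps)
qed

lemma ideal_valuation_ideal: "ideal (valuation_ideal v) R"
proof -
  interpret cring R by (rule cring_valuation_ring)
  show ?thesis
  proof (rule idealI)
    show "subgroup (valuation_ideal v) (add_monoid R)"
    proof (rule add.subgroupI)
      show "valuation_ideal v \<subseteq> carrier R" by (auto simp: valuation_ideal_def valuation_ring_simps)
      show "valuation_ideal v \<noteq> {}" by (auto simp: valuation_ideal_def intro: exI[of _ 0])
      show "\<ominus>\<^bsub>R\<^esub> a \<in> valuation_ideal v" if "a \<in> valuation_ideal v" for a
        using that by (simp add: valuation_ideal_def a_inv_valuation_ring)
      show "a \<oplus>\<^bsub>R\<^esub> b \<in> valuation_ideal v" if "a \<in> valuation_ideal v" "b \<in> valuation_ideal v" for a b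
        using that abs_add_less by (simp add: valuation_ideal_def valuation_ring_simps)
    qed
    have "v a * v x < 1" if "v a < 1" "v x \<le> 1" for a x
      using mult_mono[of "v a" "v a" "v x" 1] that by simp
    then show "x \<otimes>\<^bsub>R\<^esub> a \<in> valuation_ideal v" "a \<otimes>\<^bsub>R\<^esub> x \<in> valuation_ideal v"
      if "a \<in> valuation_ideal v" "x \<in> carrier R" for a x
      using that by (simp_all add: valuation_ideal_def valuation_ring_simps abs_mult mult.commute)
  qed (rule ring_axioms)
qed

lemma cring_residue_field: "cring F"
  unfolding residue_field_def by (rule ideal.quotient_is_cring[OF ideal_valuation_ideal cring_valuation_ring])

lemma residue_hom: "residue v \<in> ring_hom R F"
  using ideal.rcos_ring_hom[OF ideal_valuation_ideal]
  unfolding residue_field_def by (simp add: residue_def[abs_def])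

lemma residue_eq_iff:
  assumes "v x \<le> 1" "v y \<le> 1"
  shows "residue v x = residue v y \<longleftrightarrow> v (x - y) < 1"
proof -
  interpret cring R by (rule cring_valuation_ring)
  have "x \<ominus>\<^bsub>R\<^esub> y = x - y"
    using assms by (simp add: a_minus_def a_inv_valuation_ring valuation_ring_simps)
  then show ?thesis
    using quotient_eq_iff_same_a_r_cos[OF ideal_valuation_ideal, of x y] assms
    by (simp add: residue_def valuation_ring_simps valuation_ideal_def)
qed

lemma residue_mult: "v x \<le> 1 \<Longrightarrow> v y \<le> 1 \<Longrightarrow> residue v x \<otimes>\<^bsub>F\<^esub> residue v y = residue v (x * y)"
  using ring_hom_mult[OF residue_hom, of x y] by (simp add: valuation_ring_simps)

lemma residue_add: "v x \<le> 1 \<Longrightarrow> v y \<le> 1 \<Longrightarrow> residue v x \<oplus>\<^bsub>F\<^esub> residue v y = residue v (x + y)"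
  using ring_hom_add[OF residue_hom, of x y] by (simp add: valuation_ring_simps)

lemma residue_one: "\<one>\<^bsub>F\<^esub> = residue v 1"
  using ring_hom_one[OF residue_hom] by (simp add: valuation_ring_simps)

lemma residue_zero: "\<zero>\<^bsub>F\<^esub> = residue v 0"
proof -
  interpret F: cring F by (rule cring_residue_field)
  have "residue v 0 \<in> carrier F"
    using ring_hom_closed[OF residue_hom, of 0] by (simp add: valuation_ring_simps)
  moreover have "residue v 0 \<oplus>\<^bsub>F\<^esub> residue v 0 = residue v 0" by (simp add: residue_add)
  ultimately show ?thesis by (metis F.add.l_cancel_one')
qed

lemma carrier_residue_field: "carrier F = residue v ` {x. v x \<le> 1}"
  by (auto simp: residue_field_def FactRing_def A_RCOSETS_def' residue_def valuation_ring_simps)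

text \<open>
  If \<open>x y\<close> reduces to one, then \<open>\<bar>x y\<bar> = 1\<close>, which forces \<open>\<bar>x\<bar> = 1\<close> for elements of the valuation ring.
\<close>
lemma Units_residue_field: "Units F = residue v ` {x. v x = 1}"
proof (intro equalityI subsetI)
  fix b assume "b \<in> Units F"
  then obtain c where bc: "b \<in> carrier F" "c \<in> carrier F" "b \<otimes>\<^bsub>F\<^esub> c = \<one>\<^bsub>F\<^esub>" unfolding Units_def by blast
  then obtain x y where xy: "b = residue v x" "v x \<le> 1" "c = residue v y" "v y \<le> 1"
    unfolding carrier_residue_field by blast
  have xy1: "v (x * y) \<le> 1" using xy by (simp add: abs_mult mult_le_one)
  have "v (x * y - 1) < 1"
    using bc(3) xy residue_eq_iff[OF xy1, of 1] by (simp add: residue_mult residue_one)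
  then have "v (x * y) = 1" using abs_add_eq_left[of "x * y - 1" 1] by simp
  then have "v x = 1" using xy mult_mono[of "v x" "v x" "v y" 1] by (simp add: abs_mult)
  then show "b \<in> residue v ` {x. v x = 1}" using xy by blast
next
  fix b assume "b \<in> residue v ` {x. v x = 1}"
  then obtain x where x: "b = residue v x" "v x = 1" by blast
  then have "x \<noteq> 0" using abs_zero by force
  interpret F: cring F by (rule cring_residue_field)
  have "residue v (inverse x) \<otimes>\<^bsub>F\<^esub> b = \<one>\<^bsub>F\<^esub>"
    using x \<open>x \<noteq> 0\<close> by (simp add: residue_mult residue_one abs_inverse)
  moreover have "b \<in> carrier F" "residue v (inverse x) \<in> carrier F"
    using x by (auto simp: carrier_residue_field abs_inverse)
  moreover have "b \<otimes>\<^bsub>F\<^esub> residue v (inverse x) = \<one>\<^bsub>F\<^esub>"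
    using calculation F.m_comm by simp
  ultimately show "b \<in> Units F" unfolding Units_def by blast
qed

lemma residue_nonzero: "v x = 1 \<Longrightarrow> residue v x \<noteq> \<zero>\<^bsub>F\<^esub>"
  using residue_eq_iff[of x 0] by (simp add: residue_zero)

lemma abs_of_nat_residue_char_zero:
  assumes "char_zero F" "n > 0"
  shows "v (of_nat n) = 1"
proof -
  have le: "v (of_nat n) \<le> 1" for n
  proof (induction n)
    case (Suc n)
    then show ?case using abs_add_le[of 1 "of_nat n"] by simp
  qed simp
  have "add_pow F n \<one>\<^bsub>F\<^esub> = residue v (of_nat n)" for n :: nat
  proof (induction n)
    case 0
    show ?case by (simp add: add_pow_def residue_zero)
  next
    case (Suc n)
    then show ?case using le[of n] by (simp add: add_pow_def residue_one residue_add add.commute)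
  qed
  then have "residue v (of_nat n) \<noteq> residue v 0"
    using assms by (simp add: char_zero_def residue_zero)
  then have "\<not> v (of_nat n) < 1"
    using residue_eq_iff[of "of_nat n" 0] le[of n] by simp
  with le[of n] show ?thesis by simp
qed

lemma residue_int_pow:
  assumes "v x = 1"
  shows "residue v x [^]\<^bsub>units_of F\<^esub> (n::int) = residue v (x powi n)"
proof -
  interpret F: cring F by (rule cring_residue_field)
  interpret G: Group.group "units_of F" by (rule F.units_group)
  have nat: "residue v x [^]\<^bsub>units_of F\<^esub> k = residue v (x ^ k)" for k :: nat
    by (induction k) (use assms in \<open>simp_all add: nat_pow_Suc units_of_one units_of_mult residue_one
      residue_mult abs_power mult.commute\<close>)
  have "x \<noteq> 0" using assms abs_zero by force
  have "inv\<^bsub>units_of F\<^esub> (residue v (x ^ k)) = residue v (inverse (x ^ k))" for k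
  proof (rule G.inv_equality)
    show "residue v (inverse (x ^ k)) \<otimes>\<^bsub>units_of F\<^esub> residue v (x ^ k) = \<one>\<^bsub>units_of F\<^esub>"
      using assms \<open>x \<noteq> 0\<close> by (simp add: units_of_one units_of_mult residue_one residue_mult abs_power abs_inverse)
  qed (use assms in \<open>auto simp: units_of_carrier Units_residue_field abs_power abs_inverse\<close>)
  then show ?thesis
    unfolding int_pow_def2 nat by (simp add: power_int_def power_inverse)
qed

lemma residue_finprod:
  assumes "finite A" "\<And>i. i \<in> A \<Longrightarrow> v (f i) = 1"
  shows "(\<Otimes>\<^bsub>units_of F\<^esub>i\<in>A. residue v (f i)) = residue v (prod f A)"
proof -
  interpret F: cring F by (rule cring_residue_field)
  interpret G: Group.comm_group "units_of F" by (rule F.units_comm_group)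
  show ?thesis using assms
  proof (induction A rule: finite_induct)
    case empty
    then show ?case by (simp add: units_of_one residue_one)
  next
    case (insert i A)
    have "v (prod f A) = 1" using insert.prems by (simp add: abs_prod)
    moreover have "(\<Otimes>\<^bsub>units_of F\<^esub>i\<in>insert i A. residue v (f i))
        = residue v (f i) \<otimes>\<^bsub>units_of F\<^esub> (\<Otimes>\<^bsub>units_of F\<^esub>i\<in>A. residue v (f i))"
      using insert by (intro G.finprod_insert) (auto simp: units_of_carrier Units_residue_field)
    ultimately show ?case using insert by (simp add: units_of_mult residue_mult)
  qed
qed

lemma mult_dependent_residue_iff:
  fixes y :: "'n::finite \<Rightarrow> 'k"
  assumes "\<And>n. v (y n) = 1"
  shows "mult_dependent (units_of F) (\<lambda>n. residue v (y n)) \<longleftrightarrow>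
    (\<exists>l :: 'n \<Rightarrow> int. (\<exists>n. l n \<noteq> 0) \<and> v ((\<Prod>n\<in>UNIV. y n powi l n) - 1) < 1)"
proof -
  have "v (y n powi k) = 1" for n k using assms by (simp add: abs_powi)
  then have "(\<Otimes>\<^bsub>units_of F\<^esub>n\<in>UNIV. residue v (y n) [^]\<^bsub>units_of F\<^esub> l n) = \<one>\<^bsub>units_of F\<^esub>
      \<longleftrightarrow> v ((\<Prod>n\<in>UNIV. y n powi l n) - 1) < 1" for l :: "'n \<Rightarrow> int"
    using assms residue_eq_iff[of "\<Prod>n\<in>UNIV. y n powi l n" 1]
    by (simp add: residue_int_pow residue_finprod units_of_one residue_one abs_prod)
  then show ?thesis unfolding mult_dependent_def by simp
qed

text \<open>
  Dividing by the coordinate \<open>0\<close> normalises it to \<open>1\<close>.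
\<close>
lemma unit_torus_representative:
  fixes a :: "('n option \<Rightarrow> 'k) set"
  assumes "a \<in> carrier (unit_torus v)"
  obtains y :: "'n \<Rightarrow> 'k" where "\<And>n. v (y n) = 1"
    and "a = proj_point ring_of_type_algebra (case_option 1 y)"
proof -
  from assms obtain x0 x where a: "a = proj_point ring_of_type_algebra x0" and x: "x \<in> a" "\<And>i. v (x i) = 1"
    unfolding unit_torus_def proj_space_def by auto
  then obtain c where "c \<noteq> 0" "x = (\<lambda>i. c * x0 i)" unfolding proj_point_type_eq by blast
  then have ax: "a = proj_point ring_of_type_algebra x" using a proj_point_type_scale by metis
  have nz: "x None \<noteq> 0" using x(2)[of None] by auto
  define y where "y n = x (Some n) / x None" for n
  have "(\<lambda>i. inverse (x None) * x i) = case_option 1 y"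
    using nz by (auto simp: y_def fun_eq_iff divide_inverse mult.commute split: option.split)
  then have "a = proj_point ring_of_type_algebra (case_option 1 y)"
    using proj_point_type_scale[of "inverse (x None)" x] nz ax by simp
  moreover have "v (y n) = 1" for n using x(2) by (simp add: y_def divide_inverse abs_mult abs_inverse)
  ultimately show thesis using that by blast
qed

text \<open>
  Two representatives with coordinates of absolute value one differ by a factor of absolute value one,
  so their reductions differ by a unit of the residue field.
\<close>
lemma torus_reduction_proj_point:
  assumes x: "\<And>i. v (x i) = 1"
  shows "torus_reduction v (proj_point ring_of_type_algebra x) = proj_point F (\<lambda>i. residue v (x i))"
proof -
  interpret F: cring F by (rule cring_residue_field)
  have "proj_point F (\<lambda>i. residue v (z i)) = proj_point F (\<lambda>i. residue v (x i))"
    if "z \<in> proj_point ring_of_type_algebra x" "\<forall>i. v (z i) = 1" for z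
  proof -
    obtain c where c: "z = (\<lambda>i. c * x i)" using \<open>z \<in> _\<close> unfolding proj_point_type_eq by blast
    have vc: "v c = 1" using that(2) x by (simp add: c abs_mult)
    then have u: "residue v c \<in> Units F" by (auto simp: Units_residue_field)
    have carr: "residue v (x i) \<in> carrier F" for i using x by (auto simp: carrier_residue_field)
    have z: "residue v (z i) = residue v c \<otimes>\<^bsub>F\<^esub> residue v (x i)" for i
      using vc x by (simp add: c residue_mult)
    show ?thesis unfolding proj_point_def z
    proof (intro equalityI subsetI)
      fix g assume "g \<in> {\<lambda>i. d \<otimes>\<^bsub>F\<^esub> (residue v c \<otimes>\<^bsub>F\<^esub> residue v (x i)) |d. d \<in> Units F}"
      then obtain d where d: "d \<in> Units F" "g = (\<lambda>i. d \<otimes>\<^bsub>F\<^esub> (residue v c \<otimes>\<^bsub>F\<^esub> residue v (x i)))" by blast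
      then have "g = (\<lambda>i. (d \<otimes>\<^bsub>F\<^esub> residue v c) \<otimes>\<^bsub>F\<^esub> residue v (x i))" using u carr by (simp add: F.m_assoc F.Units_closed)
      then show "g \<in> {\<lambda>i. d \<otimes>\<^bsub>F\<^esub> residue v (x i) |d. d \<in> Units F}" using d(1) u by blast
    next
      fix g assume "g \<in> {\<lambda>i. d \<otimes>\<^bsub>F\<^esub> residue v (x i) |d. d \<in> Units F}"
      then obtain d where d: "d \<in> Units F" "g = (\<lambda>i. d \<otimes>\<^bsub>F\<^esub> residue v (x i))" by blast
      have "(d \<otimes>\<^bsub>F\<^esub> inv\<^bsub>F\<^esub> residue v c) \<otimes>\<^bsub>F\<^esub> (residue v c \<otimes>\<^bsub>F\<^esub> residue v (x i)) = d \<otimes>\<^bsub>F\<^esub> residue v (x i)" for i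
      proof -
        have "(d \<otimes>\<^bsub>F\<^esub> inv\<^bsub>F\<^esub> residue v c) \<otimes>\<^bsub>F\<^esub> (residue v c \<otimes>\<^bsub>F\<^esub> residue v (x i))
            = d \<otimes>\<^bsub>F\<^esub> (inv\<^bsub>F\<^esub> residue v c \<otimes>\<^bsub>F\<^esub> residue v c) \<otimes>\<^bsub>F\<^esub> residue v (x i)"
          using d(1) u carr[of i] by (simp add: F.m_assoc F.Units_closed del: F.Units_l_inv)
        then show ?thesis using d(1) u by (simp add: F.Units_closed)
      qed
      then have "g = (\<lambda>i. (d \<otimes>\<^bsub>F\<^esub> inv\<^bsub>F\<^esub> residue v c) \<otimes>\<^bsub>F\<^esub> (residue v c \<otimes>\<^bsub>F\<^esub> residue v (x i)))"
        using d(2) by simp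
      moreover have "d \<otimes>\<^bsub>F\<^esub> inv\<^bsub>F\<^esub> residue v c \<in> Units F" using d(1) u by blast
      ultimately show "g \<in> {\<lambda>i. d \<otimes>\<^bsub>F\<^esub> (residue v c \<otimes>\<^bsub>F\<^esub> residue v (x i)) |d. d \<in> Units F}" by blast
    qed
  qed
  moreover have "x \<in> {z \<in> proj_point ring_of_type_algebra x. \<forall>i. v (z i) = 1}"
    using x unfolding proj_point_type_eq by (auto intro!: exI[of _ 1])
  ultimately show ?thesis unfolding torus_reduction_def by blast
qed

text \<open>
  The coordinates \<open>b\<close> in the definition of degeneracy are determined by the point, since the coordinate
  \<open>0\<close> is normalised to \<open>1\<close>; so they are the reductions of the \<open>y n\<close>.
\<close>
lemma nondegenerate_reduction_iff:
  fixes y :: "'n::finite \<Rightarrow> 'k"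
  assumes y: "\<And>n. v (y n) = 1"
  shows "nondegenerate F (torus_reduction v (proj_point ring_of_type_algebra (case_option 1 y))) \<longleftrightarrow>
    \<not> (\<exists>l :: 'n \<Rightarrow> int. (\<exists>n. l n \<noteq> 0) \<and> v ((\<Prod>n\<in>UNIV. y n powi l n) - 1) < 1)"
proof -
  interpret F: cring F by (rule cring_residue_field)
  define r where "r = case_option \<one>\<^bsub>F\<^esub> (\<lambda>n. residue v (y n))"
  have r_simps [simp]: "r None = \<one>\<^bsub>F\<^esub>" "r (Some n) = residue v (y n)" for n
    by (simp_all add: r_def)
  have r: "residue v (case_option 1 y i) = r i" for i
    by (simp add: r_def residue_one split: option.split)
  have unit: "v (case_option 1 y i) = 1" for i using y by (simp split: option.split)
  have P: "torus_reduction v (proj_point ring_of_type_algebra (case_option 1 y)) = proj_point F r"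
    using torus_reduction_proj_point[of "case_option 1 y", OF unit] by (simp add: r)
  have units: "r i \<in> Units F" for i
    unfolding r[symmetric] Units_residue_field using unit by blast
  have nz: "u \<noteq> \<zero>\<^bsub>F\<^esub>" if "u \<in> Units F" for u
    using that residue_nonzero unfolding Units_residue_field by auto
  have "proj_point F r \<in> mult_torus F"
  proof -
    have "z i \<noteq> \<zero>\<^bsub>F\<^esub>" if z: "z \<in> proj_point F r" for z i
    proof -
      obtain c where "c \<in> Units F" "z = (\<lambda>i. c \<otimes>\<^bsub>F\<^esub> r i)" using z unfolding proj_point_def by blast
      then have "z i \<in> Units F" using units[of i] by simp
      then show ?thesis by (rule nz)
    qed
    moreover have "proj_point F r \<in> proj_space F"
      unfolding proj_space_def
      by (intro CollectI exI[of _ r] conjI allI refl exI[of _ None] F.Units_closed nz units)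
    ultimately show ?thesis by (simp add: mult_torus_def)
  qed
  moreover have "degenerate F (proj_point F r) \<longleftrightarrow> mult_dependent (units_of F) (\<lambda>n. residue v (y n))"
  proof
    assume "degenerate F (proj_point F r)"
    then obtain b where b: "\<And>n. b n \<in> Units F" "proj_point F r = proj_point F (case_option \<one>\<^bsub>F\<^esub> b)"
      "mult_dependent (units_of F) b" unfolding degenerate_def by blast
    have "r \<in> proj_point F r"
    proof -
      have "r = (\<lambda>i. \<one>\<^bsub>F\<^esub> \<otimes>\<^bsub>F\<^esub> r i)" using units F.Units_closed by (intro ext) (simp add: F.Units_closed)
      then show ?thesis unfolding proj_point_def using F.Units_one_closed by blast
    qed
    then obtain c where c: "c \<in> Units F" "r = (\<lambda>i. c \<otimes>\<^bsub>F\<^esub> case_option \<one>\<^bsub>F\<^esub> b i)"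
      unfolding b(2) unfolding proj_point_def by blast
    from fun_cong[OF c(2), of None] have "c = \<one>\<^bsub>F\<^esub>" using c(1) by (simp add: F.Units_closed)
    then have "b n = residue v (y n)" for n
      using fun_cong[OF c(2), of "Some n"] b(1)[of n] by (simp add: F.Units_closed)
    then have "b = (\<lambda>n. residue v (y n))" by blast
    with b(3) show "mult_dependent (units_of F) (\<lambda>n. residue v (y n))" by simp
  next
    assume "mult_dependent (units_of F) (\<lambda>n. residue v (y n))"
    moreover have "residue v (y n) \<in> Units F" for n using units[of "Some n"] by simp
    ultimately show "degenerate F (proj_point F r)" unfolding degenerate_def r_def
      by (intro exI[of _ "\<lambda>n. residue v (y n)"]) simp
  qed
  ultimately show ?thesis
    unfolding nondegenerate_def P mult_dependent_residue_iff[OF y] by simp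
qed

end

section \<open>Continuous test functions and the criterion\<close>

lemma homogeneous_single: "homogeneous (\<Sum>i\<in>UNIV. Poly_Mapping.lookup m i) (Poly_Mapping.single m c)"
  by (cases "c = 0") (simp_all add: homogeneous_def)

lemma homogeneous_add:
  assumes "homogeneous d f" "homogeneous d g"
  shows "homogeneous d (f + g)"
  using assms keys_add[of f g] unfolding homogeneous_def by blast

lemma continuous_map_berk_eval:
  "continuous_map (subtopology (berk_affine_topology v) (berk_punctured v)) euclideanreal (\<lambda>\<zeta>. \<zeta> f)"
proof (rule continuous_map_from_subtopology)
  have "openin (berk_affine_topology v) {\<zeta> \<in> berk_affine v. \<zeta> f \<in> U}" if "open U" for U
    unfolding berk_affine_topology_def using that by (intro topology_generated_by_Basis) blast
  then show "continuous_map (berk_affine_topology v) euclideanreal (\<lambda>\<zeta>. \<zeta> f)"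
    by (simp add: continuous_map_def)
qed

context valued_field
begin

lemma berk_affine_add_null:
  assumes \<zeta>: "\<zeta> \<in> berk_affine v" and "\<zeta> g = 0"
  shows "\<zeta> (f + g) = \<zeta> f"
proof -
  have add: "\<zeta> (p + q) \<le> max (\<zeta> p) (\<zeta> q)" and mult: "\<zeta> (p * q) = \<zeta> p * \<zeta> q" and nonneg: "0 \<le> \<zeta> p" for p q
    using \<zeta> unfolding berk_affine_def by blast+
  \<comment> \<open>Negation is multiplication by the constant \<open>-1\<close>, so \<open>- g\<close> is null as well.\<close>
  have "- g = mconst (- 1) * g" by (simp add: single_uminus)
  then have "\<zeta> (- g) = 0" using mult assms(2) by simp
  moreover have "f = (f + g) + (- g)" by simp
  ultimately have "\<zeta> f \<le> max (\<zeta> (f + g)) 0" using add by metis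
  moreover have "\<zeta> (f + g) \<le> max (\<zeta> f) 0" using add[of f g] assms(2) by simp
  ultimately show ?thesis using nonneg[of f] nonneg[of "f + g"] by simp
qed

text \<open>
  Where all variables are null, so is every monomial other than \<open>1\<close>, and only the constant term counts.
  Hence such a point is the origin.
\<close>
lemma berk_affine_origin:
  fixes \<zeta> :: "('i::finite, 'k) mpoly \<Rightarrow> real"
  assumes \<zeta>: "\<zeta> \<in> berk_affine v" and zero: "\<And>i. \<zeta> (mvar i) = 0"
  shows "\<zeta> f = v (Poly_Mapping.lookup f 0)"
proof -
  have mult: "\<zeta> (p * q) = \<zeta> p * \<zeta> q" and const: "\<zeta> (mconst c) = v c" for p q c
    using \<zeta> unfolding berk_affine_def by blast+
  have null: "\<zeta> (Poly_Mapping.single m c) = 0" if "m \<noteq> 0" for m c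
  proof -
    obtain i where i: "Poly_Mapping.lookup m i \<noteq> 0"
      using \<open>m \<noteq> 0\<close> by (metis lookup_zero poly_mapping_eqI)
    have "m = Poly_Mapping.single i (Suc 0) + (m - Poly_Mapping.single i (Suc 0))"
      using i by (intro poly_mapping_eqI) (auto simp: lookup_add lookup_minus lookup_single when_def)
    then have "Poly_Mapping.single m c = mvar i * Poly_Mapping.single (m - Poly_Mapping.single i (Suc 0)) c"
      by (simp add: mult_single)
    then show ?thesis using mult zero by simp
  qed
  have "\<zeta> (mconst c + (\<Sum>m\<in>A. Poly_Mapping.single m (C m))) = v c" if "finite A" "0 \<notin> A" for A c and C :: "_ \<Rightarrow> 'k"
    using that
  proof (induction A rule: finite_induct)
    case empty
    then show ?case by (simp add: const)
  next
    case (insert m A)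
    have "mconst c + (\<Sum>m\<in>insert m A. Poly_Mapping.single m (C m))
        = (mconst c + (\<Sum>m\<in>A. Poly_Mapping.single m (C m))) + Poly_Mapping.single m (C m)"
      using insert.hyps by (simp add: add_ac)
    moreover have "\<zeta> (Poly_Mapping.single m (C m)) = 0" using insert.prems by (intro null) auto
    then have "\<zeta> ((mconst c + (\<Sum>m\<in>A. Poly_Mapping.single m (C m))) + Poly_Mapping.single m (C m)) = v c"
      using insert.IH insert.prems berk_affine_add_null[OF \<zeta>] by simp
    ultimately show ?case by (simp only:)
  qed
  from this[of "Poly_Mapping.keys f - {0}" "Poly_Mapping.lookup f 0" "Poly_Mapping.lookup f"]
  have *: "\<zeta> (mconst (Poly_Mapping.lookup f 0)
      + (\<Sum>m\<in>Poly_Mapping.keys f - {0}. Poly_Mapping.single m (Poly_Mapping.lookup f m))) = v (Poly_Mapping.lookup f 0)"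
    by simp
  have "mconst (Poly_Mapping.lookup f 0)
      + (\<Sum>m\<in>Poly_Mapping.keys f - {0}. Poly_Mapping.single m (Poly_Mapping.lookup f m)) = f"
  proof (cases "0 \<in> Poly_Mapping.keys f")
    case True
    then show ?thesis
      using sum.remove[of "Poly_Mapping.keys f" 0 "\<lambda>m. Poly_Mapping.single m (Poly_Mapping.lookup f m)"]
      by (simp add: sum_single_lookup)
  next
    case False
    then show ?thesis using sum_single_lookup[of f] by (simp add: in_keys_iff)
  qed
  with * show ?thesis by simp
qed

text \<open>
  This makes the sum of the coordinate functions usable as a denominator on the punctured space.
\<close>
lemma sum_mvar_pos:
  assumes "\<zeta> \<in> berk_punctured v"
  shows "(\<Sum>i\<in>UNIV. \<zeta> (mvar i)) > 0"
proof (rule ccontr)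
  have \<zeta>: "\<zeta> \<in> berk_affine v" using assms by (simp add: berk_punctured_def)
  then have nonneg: "0 \<le> \<zeta> p" for p unfolding berk_affine_def by blast
  assume "\<not> ?thesis"
  then have "(\<Sum>i\<in>UNIV. \<zeta> (mvar i)) = 0" using nonneg by (meson linorder_not_less order_antisym sum_nonneg)
  then have zero: "\<zeta> (mvar i) = 0" for i using nonneg by (simp add: sum_nonneg_eq_0_iff)
  have "eval_seminorm v (\<lambda>_. 0) (mvar i) = 0" for i by (simp add: eval_seminorm_mvar)
  note origin = berk_affine_origin[OF eval_seminorm_in_berk_affine this]
  have "\<zeta> = eval_seminorm v (\<lambda>_. 0)"
    by (rule ext) (simp only: berk_affine_origin[OF \<zeta> zero] origin)
  with assms show False by (simp add: berk_punctured_def)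
qed

text \<open>
  The quotient is invariant under scaling because numerator and denominator are homogeneous of the same
  degree, so it descends to the quotient space.
\<close>
lemma homogeneous_test_function:
  fixes f :: "('i::finite, 'k) mpoly"
  assumes f: "homogeneous d f"
  obtains \<phi> where "continuous_map (berk_proj_topology v) euclideanreal \<phi>"
    and "\<And>\<zeta>. \<zeta> \<in> berk_punctured v \<Longrightarrow> \<phi> (berk_pi v \<zeta>) = \<zeta> f / (\<Sum>i\<in>UNIV. \<zeta> (mvar i)) ^ d"
proof -
  let ?X = "subtopology (berk_affine_topology v) (berk_punctured v) :: (('i, 'k) mpoly \<Rightarrow> real) topology"
  define g where "g \<zeta> = \<zeta> f * inverse ((\<Sum>i\<in>UNIV. \<zeta> (mvar i)) ^ d)" for \<zeta> :: "('i, 'k) mpoly \<Rightarrow> real"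
  have nz: "(\<Sum>i\<in>UNIV. \<zeta> (mvar i)) ^ d \<noteq> 0" if "\<zeta> \<in> topspace ?X" for \<zeta>
    using sum_mvar_pos[of \<zeta>] that unfolding topspace_berk_punctured by simp
  have cont: "continuous_map ?X euclideanreal g"
    unfolding g_def
    by (intro continuous_map_real_mult continuous_map_real_inverse continuous_map_real_pow
        continuous_map_sum continuous_map_berk_eval nz finite)
  have inv: "g \<zeta> = g \<xi>"
    if "\<zeta> \<in> topspace ?X" "\<xi> \<in> topspace ?X" "berk_pi v \<zeta> = berk_pi v \<xi>" for \<zeta> \<xi>
  proof -
    have "\<xi> \<in> berk_punctured v" using that(2) unfolding topspace_berk_punctured .
    then have "(\<zeta>, \<xi>) \<in> berk_equiv v"
      using that(3) unfolding berk_pi_def by (intro eq_equiv_class[OF _ equiv_berk_equiv])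
    then obtain r where r: "r > 0" "\<And>d f. homogeneous d f \<Longrightarrow> \<zeta> f = r ^ d * \<xi> f"
      unfolding berk_equiv_def by blast
    have "homogeneous 1 (mvar i :: ('i, 'k) mpoly)" for i
      using homogeneous_single[of "Poly_Mapping.single i (Suc 0)" "1::'k"] by (simp add: lookup_single when_def)
    then have "\<zeta> (mvar i) = r * \<xi> (mvar i)" for i using r(2)[of 1 "mvar i"] by simp
    then have "(\<Sum>i\<in>UNIV. \<zeta> (mvar i)) ^ d = r ^ d * (\<Sum>i\<in>UNIV. \<xi> (mvar i)) ^ d"
      by (simp add: power_mult_distrib flip: sum_distrib_left)
    then show ?thesis using r(1) r(2)[OF f] by (simp add: g_def)
  qed
  show thesis
  proof (rule quotient_map_lift_exists[OF quotient_map_berk_pi cont])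
    fix \<phi> assume "continuous_map (berk_proj_topology v) euclideanreal \<phi>"
      and "\<And>\<zeta>. \<zeta> \<in> topspace ?X \<Longrightarrow> \<phi> (berk_pi v \<zeta>) = g \<zeta>"
    then show thesis
      using that[of \<phi>] unfolding topspace_berk_punctured g_def by (simp add: divide_inverse)
  qed (rule inv)
qed

lemma monom_value_case_option:
  fixes y :: "'n::finite \<Rightarrow> 'k"
  shows "monom_value (case_option 1 y) m = (\<Prod>n\<in>UNIV. y n ^ Poly_Mapping.lookup m (Some n))"
  unfolding monom_value_def UNIV_option_conv by (simp add: prod.reindex)

lemma sum_option: "(\<Sum>i\<in>UNIV. g i) = g None + (\<Sum>n\<in>UNIV. g (Some (n::'n::finite)))" for g :: "_ \<Rightarrow> nat"
  unfolding UNIV_option_conv by (simp add: sum.reindex)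

lemma monom_value_ratio:
  fixes y :: "'n::finite \<Rightarrow> 'k"
  assumes y: "\<And>n. v (y n) = 1"
  shows "monom_value (case_option 1 y) m = monom_value (case_option 1 y) m'
    * (\<Prod>n\<in>UNIV. y n powi (int (Poly_Mapping.lookup m (Some n)) - int (Poly_Mapping.lookup m' (Some n))))"
proof -
  have "y n \<noteq> 0" for n using y[of n] by auto
  then show ?thesis
    unfolding monom_value_case_option prod.distrib[symmetric]
    by (intro prod.cong) (simp_all add: power_int_diff)
qed

text \<open>
  The quotient of two monomials at \<open>(1, y)\<close> is a product \<open>\<Prod>n. y n powi l n\<close>, where \<open>l\<close> is the difference
  of the exponents of the variables other than \<open>X\<^sub>0\<close>. For equal degrees, \<open>l = 0\<close> also forces the exponents of
  \<open>X\<^sub>0\<close> to agree.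
\<close>
lemma generic_of_independent:
  fixes y :: "'n::finite \<Rightarrow> 'k"
  assumes y: "\<And>n. v (y n) = 1"
    and independent: "\<not> (\<exists>l :: 'n \<Rightarrow> int. (\<exists>n. l n \<noteq> 0) \<and> v ((\<Prod>n\<in>UNIV. y n powi l n) - 1) < 1)"
  shows "generic (case_option 1 y)"
    and "\<And>m m'. monom_value (case_option 1 y) m = monom_value (case_option 1 y) m' \<Longrightarrow>
      (\<Sum>i\<in>UNIV. Poly_Mapping.lookup m i) = (\<Sum>i\<in>UNIV. Poly_Mapping.lookup m' i) \<Longrightarrow> m = m'"
proof -
  have indep: "\<forall>n. l n = 0" if "v ((\<Prod>n\<in>UNIV. y n powi l n) - 1) < 1" for l
    using independent that by blast
  let ?x = "case_option 1 y"
  let ?l = "\<lambda>m m' n. int (Poly_Mapping.lookup m (Some n)) - int (Poly_Mapping.lookup m' (Some n))"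
  have x: "v (?x i) = 1" for i using y by (simp split: option.split)
  then have val: "v (monom_value ?x m) = 1" for m by (simp add: monom_value_def abs_prod abs_power)
  show "generic ?x"
    unfolding generic_def
  proof (intro conjI allI impI x)
    fix m m' :: "'n option \<Rightarrow>\<^sub>0 nat" and d :: nat
    assume d: "0 < d" and ne: "monom_value ?x m \<noteq> monom_value ?x m'"
    let ?u = "\<Prod>n\<in>UNIV. y n powi ?l m m' n"
    have "\<not> (\<forall>n. ?l m m' n = 0)"
    proof
      assume "\<forall>n. ?l m m' n = 0"
      then have "Poly_Mapping.lookup m (Some n) = Poly_Mapping.lookup m' (Some n)" for n by simp
      then show False using ne by (simp add: monom_value_case_option)
    qed
    then have "\<not> (\<forall>n. int d * ?l m m' n = 0)" using d by simp
    moreover have ud: "(\<Prod>n\<in>UNIV. y n powi (int d * ?l m m' n)) = ?u ^ d"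
      by (simp add: prod_power_distrib power_int_power' mult.commute)
    ultimately have ge: "\<not> v (?u ^ d - 1) < 1" using indep[of "\<lambda>n. int d * ?l m m' n"] by auto
    have "v ?u = 1" using y by (simp add: abs_prod abs_powi)
    then have "v (?u ^ d - 1) \<le> 1" using abs_diff_le[of "?u ^ d" 1] by (simp add: abs_power)
    with ge have "v (?u ^ d - 1) = 1" by simp
    moreover have "monom_value ?x m ^ d - monom_value ?x m' ^ d = monom_value ?x m' ^ d * (?u ^ d - 1)"
      using monom_value_ratio[of y m m', OF y] by (simp add: algebra_simps power_mult_distrib)
    ultimately show "v (monom_value ?x m ^ d - monom_value ?x m' ^ d) = 1"
      by (simp add: abs_mult abs_power val)
  qed
  fix m m' :: "'n option \<Rightarrow>\<^sub>0 nat"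
  assume eq: "monom_value ?x m = monom_value ?x m'"
    and deg: "(\<Sum>i\<in>UNIV. Poly_Mapping.lookup m i) = (\<Sum>i\<in>UNIV. Poly_Mapping.lookup m' i)"
  have "monom_value ?x m' \<noteq> 0" using val[of m'] by auto
  then have "(\<Prod>n\<in>UNIV. y n powi ?l m m' n) = 1"
    using monom_value_ratio[of y m m', OF y] eq by simp
  then have "\<forall>n. ?l m m' n = 0" by (intro indep) simp
  then have some: "Poly_Mapping.lookup m (Some n) = Poly_Mapping.lookup m' (Some n)" for n by simp
  then have none: "Poly_Mapping.lookup m None = Poly_Mapping.lookup m' None" using deg unfolding sum_option by simp
  show "m = m'"
  proof (rule poly_mapping_eqI)
    fix i show "Poly_Mapping.lookup m i = Poly_Mapping.lookup m' i" using some none by (cases i) auto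
  qed
qed

text \<open>
  Separate the positive from the negative exponents and use the variable \<open>X\<^sub>0\<close>, whose value is \<open>1\<close>, to
  make the degrees equal.
\<close>
lemma homogeneous_relation:
  fixes y :: "'n::finite \<Rightarrow> 'k" and l :: "'n \<Rightarrow> int"
  assumes y: "\<And>n. v (y n) = 1" and l: "l n0 \<noteq> 0"
  obtains m m' where "m \<noteq> m'"
    and "(\<Sum>i\<in>UNIV. Poly_Mapping.lookup m i) = (\<Sum>i\<in>UNIV. Poly_Mapping.lookup m' i)"
    and "monom_value (case_option 1 y) m = monom_value (case_option 1 y) m' * (\<Prod>n\<in>UNIV. y n powi l n)"
proof -
  \<comment> \<open>The exponent of \<open>X\<^sub>0\<close> in \<open>e k\<close> is chosen to make the degrees of \<open>e k\<close> and \<open>e (- k)\<close> both equal to \<open>\<Sum>n. \<bar>k n\<bar>\<close>.\<close>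
  define e where "e k = Abs_poly_mapping (case_option (\<Sum>n\<in>UNIV. nat (- k n)) (\<lambda>n. nat (k n)))" for k :: "'n \<Rightarrow> int"
  have e: "Poly_Mapping.lookup (e k) = case_option (\<Sum>n\<in>UNIV. nat (- k n)) (\<lambda>n. nat (k n))" for k
    unfolding e_def by (rule lookup_Abs_poly_mapping) simp
  have diff: "int (Poly_Mapping.lookup (e l) (Some n))
      - int (Poly_Mapping.lookup (e (\<lambda>n. - l n)) (Some n)) = l n" for n
    by (simp add: e)
  have "e l \<noteq> e (\<lambda>n. - l n)"
  proof
    assume "e l = e (\<lambda>n. - l n)"
    then have "Poly_Mapping.lookup (e l) (Some n0) = Poly_Mapping.lookup (e (\<lambda>n. - l n)) (Some n0)" by simp
    then show False using l by (simp add: e)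
  qed
  moreover have "(\<Sum>i\<in>UNIV. Poly_Mapping.lookup (e l) i) = (\<Sum>i\<in>UNIV. Poly_Mapping.lookup (e (\<lambda>n. - l n)) i)"
    unfolding sum_option by (simp add: e)
  moreover have "monom_value (case_option 1 y) (e l)
      = monom_value (case_option 1 y) (e (\<lambda>n. - l n)) * (\<Prod>n\<in>UNIV. y n powi l n)"
    using monom_value_ratio[of y "e l" "e (\<lambda>n. - l n)", OF y] by (simp only: diff)
  ultimately show thesis by (rule that)
qed

lemma abs_power_minus_one_le:
  assumes "v u = 1"
  shows "v (u ^ j - 1) \<le> v (u - 1)"
proof -
  have "v (\<Sum>i<j. u ^ i) \<le> 1" using assms by (intro abs_sum_le) (simp_all add: abs_power)
  then have "v (u - 1) * v (\<Sum>i<j. u ^ i) \<le> v (u - 1) * 1" by (intro mult_left_mono) auto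
  then show ?thesis by (simp add: power_diff_1_eq abs_mult)
qed

lemma measurable_berk_proj_borel:
  fixes \<phi> :: "(('i::finite, 'k) mpoly \<Rightarrow> real) set \<Rightarrow> real"
  assumes "continuous_map (berk_proj_topology v) euclideanreal \<phi>"
  shows "\<phi> \<in> borel_measurable (berk_proj_borel v)"
proof (rule borel_measurableI)
  have sub: "{U. openin (berk_proj_topology v) U} \<subseteq> Pow (berk_proj v :: (('i, 'k) mpoly \<Rightarrow> real) set set)"
    using openin_subset by fastforce
  fix S :: "real set" assume "open S"
  then have "openin (berk_proj_topology v) {x \<in> topspace (berk_proj_topology v). \<phi> x \<in> S}"
    using openin_continuous_map_preimage[OF assms] by simp
  moreover have "{x \<in> topspace (berk_proj_topology v). \<phi> x \<in> S} = \<phi> -` S \<inter> space (berk_proj_borel v)"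
    using sub by (auto simp: berk_proj_borel_def space_measure_of)
  ultimately show "\<phi> -` S \<inter> space (berk_proj_borel v) \<in> sets (berk_proj_borel v)"
    using sub by (simp add: berk_proj_borel_def)
qed

lemma equidistributed_return_iff:
  fixes p :: "nat \<Rightarrow> (('i::finite, 'k) mpoly \<Rightarrow> real) set"
  assumes "\<gamma> \<in> berk_proj v"
  shows "equidistributed (berk_proj_topology v) (return (berk_proj_borel v) \<gamma>)
      (\<lambda>l. {# p j. j \<in># mset_set {1..Suc l} #}) \<longleftrightarrow>
    (\<forall>\<phi>. continuous_map (berk_proj_topology v) euclideanreal \<phi> \<longrightarrow>
      (\<lambda>l. (\<Sum>j\<in>{1..Suc l}. \<phi> (p j)) / real (Suc l)) \<longlonglongrightarrow> \<phi> \<gamma>)"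
proof -
  have "space (berk_proj_borel v) = (berk_proj v :: (('i, 'k) mpoly \<Rightarrow> real) set set)"
  proof -
    have "{U. openin (berk_proj_topology v) U} \<subseteq> Pow (berk_proj v :: (('i, 'k) mpoly \<Rightarrow> real) set set)"
      using openin_subset by fastforce
    then show ?thesis by (simp add: berk_proj_borel_def space_measure_of)
  qed
  then have "(\<integral>z. \<phi> z \<partial>return (berk_proj_borel v) \<gamma>) = \<phi> \<gamma>"
    if "continuous_map (berk_proj_topology v) euclideanreal \<phi>" for \<phi>
    using assms by (intro integral_return measurable_berk_proj_borel that) simp
  moreover have "(\<Sum>z\<in>#{# p j. j \<in># mset_set A #}. \<phi> z) = (\<Sum>j\<in>A. \<phi> (p j))" for \<phi> :: "_ \<Rightarrow> real" and A
    by (simp add: sum_unfold_sum_mset image_mset.compositionality comp_def)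
  ultimately show ?thesis unfolding equidistributed_def by (simp del: of_nat_Suc)
qed

end

theorem theorem1:
  fixes v :: "'k::field \<Rightarrow> real"
    and w :: "'c::field \<Rightarrow> real"
    and \<iota> :: "'k alg_closure \<Rightarrow> 'c"
    and a :: "('n::finite option \<Rightarrow> 'k) set"
  assumes "nonarch_abs v" and "nontrivial_abs v" and "complete_abs v"
    and "completed_alg_closure v w \<iota>"
    and "char_zero (residue_field v)"
    and "a \<in> carrier (unit_torus v)"
  shows "equidistributed (berk_proj_topology v)
           (return (berk_proj_borel v) (gauss_point v w \<iota>))
           (\<lambda>l. {# berk_incl v (a [^]\<^bsub>unit_torus v\<^esub> j). j \<in># mset_set {1..Suc l} #})
         \<longleftrightarrow> nondegenerate (residue_field v) (torus_reduction v a)"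
proof -
  interpret valued_field v by unfold_locales (rule assms(1))
  note char0 = abs_of_nat_residue_char_zero[OF assms(5)]
  obtain y :: "'n \<Rightarrow> 'k" where y: "\<And>n. v (y n) = 1"
    and a: "a = proj_point ring_of_type_algebra (case_option 1 y)"
    using unit_torus_representative[OF assms(6)] by blast
  define x where "x = case_option 1 y"
  have vx: "v (x i) = 1" for i using y by (simp add: x_def split: option.split)
  define e where "e j = eval_seminorm v (\<lambda>i. x i ^ j)" for j
  have xj: "x i ^ j \<noteq> 0" for i j using vx[of i] by auto
  have e_punctured: "e j \<in> berk_punctured v" for j
    unfolding e_def by (rule eval_seminorm_in_berk_punctured[of _ None]) (rule xj)
  have points: "berk_incl v (a [^]\<^bsub>unit_torus v\<^esub> j) = berk_pi v (e j)" for j :: nat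
    unfolding a unit_torus_pow e_def x_def[symmetric] by (rule berk_incl_proj_point[of _ None]) (rule xj)
  let ?G = "gauss_norm :: ('n option, 'k) mpoly \<Rightarrow> real"
  have G: "?G \<in> berk_affine v" using gauss_norm_in_berk_affine char0 by blast
  have G_punctured: "?G \<in> berk_punctured v"
    by (rule berk_punctured_if_mvar[OF G, of None]) simp
  have "gauss_seminorm w \<iota> = ?G"
    using gauss_seminorm_eq_gauss_norm[OF char0 assms(4)] by (intro ext) blast
  then have gauss: "gauss_point v w \<iota> = berk_pi v ?G" by (simp add: gauss_point_def)
  have "berk_pi v ?G \<in> berk_proj v"
    unfolding berk_proj_def berk_pi_def by (rule quotientI) (rule G_punctured)
  note equi = equidistributed_return_iff[OF this, of "\<lambda>j. berk_pi v (e j)"]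
  have "(\<forall>\<phi>. continuous_map (berk_proj_topology v) euclideanreal \<phi> \<longrightarrow>
      (\<lambda>l. (\<Sum>j\<in>{1..Suc l}. \<phi> (berk_pi v (e j))) / real (Suc l)) \<longlonglongrightarrow> \<phi> (berk_pi v ?G)) \<longleftrightarrow>
    \<not> (\<exists>l :: 'n \<Rightarrow> int. (\<exists>n. l n \<noteq> 0) \<and> v ((\<Prod>n\<in>UNIV. y n powi l n) - 1) < 1)"
    (is "?conv \<longleftrightarrow> \<not> ?dependent")
  proof
    assume indep: "\<not> ?dependent"
    have gen: "generic x" unfolding x_def by (rule generic_of_independent(1)[of y, OF y indep])
    have "berk_pi v (generic_limit x) = berk_pi v ?G"
    proof (rule berk_pi_generic_limit[OF gen _ G])
      show "m = m'" if "monom_value x m = monom_value x m'"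
        "(\<Sum>i\<in>UNIV. Poly_Mapping.lookup m i) = (\<Sum>i\<in>UNIV. Poly_Mapping.lookup m' i)" for m m'
        using that unfolding x_def by (rule generic_of_independent(2)[of y, OF y indep])
    qed
    then show ?conv
      using generic_powers_equidistribute[OF gen] unfolding e_def by simp
  next
    assume conv: ?conv
    show "\<not> ?dependent"
    proof
      assume ?dependent
      then obtain l n0 where l: "l n0 \<noteq> 0" and "v ((\<Prod>n\<in>UNIV. y n powi l n) - 1) < 1" by blast
      define u where "u = (\<Prod>n\<in>UNIV. y n powi l n)"
      have u1: "v (u - 1) < 1" using \<open>v ((\<Prod>n\<in>UNIV. y n powi l n) - 1) < 1\<close> by (simp add: u_def)
      have vu: "v u = 1" using y by (simp add: u_def abs_prod abs_powi)
      obtain m m' where "m \<noteq> m'"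
        and deg: "(\<Sum>i\<in>UNIV. Poly_Mapping.lookup m i) = (\<Sum>i\<in>UNIV. Poly_Mapping.lookup m' i)"
        and ratio: "monom_value x m = monom_value x m' * u"
        using homogeneous_relation[of y l n0, OF y l] unfolding x_def u_def by blast
      define f :: "('n option, 'k) mpoly" where "f = Poly_Mapping.single m 1 + Poly_Mapping.single m' (- 1)"
      define D where "D = (\<Sum>i\<in>UNIV. Poly_Mapping.lookup m i)"
      \<comment> \<open>Each of the \<open>N\<close> coordinate functions has the value \<open>1\<close> at the points \<open>e j\<close> and at the Gauss norm.\<close>
      define N where "N = real CARD('n option)"
      have Npos: "N ^ D > 0" by (simp add: N_def)
      have "homogeneous D f"
        unfolding f_def
      proof (rule homogeneous_add)
        show "homogeneous D (Poly_Mapping.single m (1::'k))"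
          unfolding D_def by (rule homogeneous_single)
        show "homogeneous D (Poly_Mapping.single m' (- 1::'k))"
          unfolding D_def deg by (rule homogeneous_single)
      qed
      then obtain \<phi> where \<phi>: "continuous_map (berk_proj_topology v) euclideanreal \<phi>"
        "\<And>\<zeta>. \<zeta> \<in> berk_punctured v \<Longrightarrow> \<phi> (berk_pi v \<zeta>) = \<zeta> f / (\<Sum>i\<in>UNIV. \<zeta> (mvar i)) ^ D"
        using homogeneous_test_function by blast
      have upper: "\<phi> (berk_pi v (e j)) \<le> v (u - 1) / N ^ D" for j
      proof -
        have "mpoly_eval id f (\<lambda>i. x i ^ j) = monom_value x m' ^ j * (u ^ j - 1)"
          by (simp add: f_def mpoly_eval_add monom_value_power ratio power_mult_distrib algebra_simps)
        then have "e j f = v (u ^ j - 1)"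
          using vx by (simp add: e_def eval_seminorm_def abs_mult abs_power monom_value_def abs_prod)
        moreover have "(\<Sum>i\<in>UNIV. e j (mvar i)) = N"
          unfolding e_def eval_seminorm_mvar by (simp add: vx abs_power N_def)
        ultimately show ?thesis
          using \<phi>(2)[OF e_punctured] abs_power_minus_one_le[OF vu, of j] Npos
          by (simp add: divide_right_mono)
      qed
      have lower: "1 / N ^ D \<le> \<phi> (berk_pi v ?G)"
      proof -
        have "Poly_Mapping.lookup f m = 1" using \<open>m \<noteq> m'\<close> by (simp add: f_def lookup_add lookup_single)
        then have "1 \<le> ?G f" using gauss_norm_ge[of f m] by simp
        moreover have "(\<Sum>i\<in>UNIV. ?G (mvar i)) = N" by (simp add: N_def)
        ultimately show ?thesis using \<phi>(2)[OF G_punctured] Npos by (simp add: divide_right_mono)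
      qed
      have "(\<lambda>l. (\<Sum>j\<in>{1..Suc l}. \<phi> (berk_pi v (e j))) / real (Suc l)) \<longlonglongrightarrow> \<phi> (berk_pi v ?G)"
        using conv \<phi>(1) by blast
      moreover have "(\<Sum>j\<in>{1..Suc l}. \<phi> (berk_pi v (e j))) / real (Suc l) \<le> v (u - 1) / N ^ D" for l
      proof -
        have "(\<Sum>j\<in>{1..Suc l}. \<phi> (berk_pi v (e j))) \<le> real (card {1..Suc l}) * (v (u - 1) / N ^ D)"
          by (rule sum_bounded_above) (rule upper)
        then show ?thesis by (simp add: divide_le_eq mult.commute del: of_nat_Suc)
      qed
      ultimately have "\<phi> (berk_pi v ?G) \<le> v (u - 1) / N ^ D" by (intro LIMSEQ_le_const2) auto
      with lower have "1 / N ^ D \<le> v (u - 1) / N ^ D" by simp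
      then show False using u1 Npos by (simp add: divide_le_cancel)
    qed
  qed
  then show ?thesis
    unfolding points gauss equi
    unfolding a nondegenerate_reduction_iff[OF y] .
qed

end
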